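(* Let $\Phi=(G,\varphi)$ be a connected $\mathbb{T}$-gain graph on $n$ vertices with maximum vertex degree $\Delta\geq 2$, let $\alpha\in[0,1)$, and let $m_\alpha(\Phi,\lambda)$ denote the multiplicity of $\lambda$ as an eigenvalue of $A_\alpha(\Phi)$. Then $$m_\alpha(\Phi,\lambda)\leq \frac{(\Delta-2)n+2}{\Delta-1}.$$ Equality occurs if and only if one of the following holds: (i) $G=K_n$, and there is an eigenvalue $\mu$ of $A(\Phi)$ of multiplicity $n-1$ such that $\lambda=\alpha(n-1)+(1-\alpha)\mu$; (ii) $G=C_n$ with $\varphi(C_n)=1$ and $\lambda\in\left\{2\alpha+2(1-\alpha)\cos\left(\frac{2\pi j}{n}\right): j=1,\dots,\lceil\frac{n}{2}\rceil-1\right\}$; (iii) $G=C_n$ with $\varphi(C_n)=-1$ and $\lambda\in\left\{2\alpha+2(1-\alpha)\cos\left(\frac{(2j+1)\pi}{n}\right): j=0,1,\dots,\lfloor\frac{n}{2}\rfloor-1\right\}$; (iv) $n$ is even, $G=K_{\frac n2,\frac n2}$, $\Phi\sim(K_{\frac n2,\frac n2},1)$ and $\lambda=\frac{\alpha n}{2}$.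
   Context: Let $\mathbb{T}=\{z\in\mathbb{C}:|z|=1\}$. Let $G$ be a finite simple undirected graph with vertices $v_1,\dots,v_n$. For each edge $e_{s,t}$ joining $v_s$ and $v_t$ there are two oriented edges $\overrightarrow{e_{s,t}}$ (from $v_s$ to $v_t$) and $\overrightarrow{e_{t,s}}$. A $\mathbb{T}$-gain graph (complex unit gain graph) $\Phi=(G,\varphi)$ is a graph $G$ with a function $\varphi$ from oriented edges to $\mathbb{T}$ satisfying $\varphi(\overrightarrow{e_{s,t}})=\varphi(\overrightarrow{e_{t,s}})^{-1}$. It is connected if $G$ is, and its maximum vertex degree is that of $G$. Its adjacency matrix $A(\Phi)$ is the Hermitian $n\times n$ matrix with $(s,t)$ entry $\varphi(\overrightarrow{e_{s,t}})$ if $v_s$ and $v_t$ are adjacent and $0$ otherwise. $D(\Phi)$ is the diagonal matrix of vertex degrees of $G$, and $A_\alpha(\Phi)=\alpha D(\Phi)+(1-\alpha)A(\Phi)$. $K_n$, $C_n$, $K_{m,n}$ denote the complete graph, the cycle, and the complete bipartite graph. For a $\mathbb{T}$-gain graph on the cycle $C_n$, $\varphi(\overrightarrow{C_n})$ is the product of the gains of the consecutive oriented edges when traversing the cycle in one direction; when this number is real it does not depend on the direction and is written $\varphi(C_n)$. Two $\mathbb{T}$-gain graphs $(G,\varphi_1)$ and $(G,\varphi_2)$ are switching equivalent, written $\sim$, if there is $\zeta:V(G)\to\mathbb{T}$ with $\varphi_1(\overrightarrow{e_{i,j}})=\zeta(v_i)^{-1}\varphi_2(\overrightarrow{e_{i,j}})\zeta(v_j)$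 for all edges $e_{i,j}$. $(G,1)$ denotes the $\mathbb{T}$-gain graph with all gains equal to $1$. *)

theory Defs
  imports
    "Graph_Theory.Graph_Theory"
    "Jordan_Normal_Form.Char_Poly"
    Complex_Main
begin

text \<open>
  A finite simple undirected graph is a \<^locale>\<open>pair_graph\<close>: a finite, loop-free, symmetric
  relation on the vertices. Its arcs are the oriented edges, both orientations being present,
  so the degree of a vertex is its out-degree.
\<close>

definition max_degree :: "'a pair_pre_digraph \<Rightarrow> nat" where
  "max_degree G = Max (out_degree (with_proj G) ` pverts G)"

locale gain_graph = pair_graph G for G :: "'a pair_pre_digraph" +
  fixes \<phi> :: "'a \<times> 'a \<Rightarrow> complex"
  assumes gain_unit: "e \<in> parcs G \<Longrightarrow> cmod (\<phi> e) = 1"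
    and gain_inverse: "(s, t) \<in> parcs G \<Longrightarrow> \<phi> (s, t) = inverse (\<phi> (t, s))"

text \<open>
  In the following matrices, \<open>v\<close> enumerates the vertices as \<open>v 0, \<dots>, v (n - 1)\<close>.
\<close>

definition gain_adj_mat ::
    "'a pair_pre_digraph \<Rightarrow> ('a \<times> 'a \<Rightarrow> complex) \<Rightarrow> nat \<Rightarrow> (nat \<Rightarrow> 'a) \<Rightarrow> complex mat" where
  "gain_adj_mat G \<phi> n v =
     mat n n (\<lambda>(s, t). if (v s, v t) \<in> parcs G then \<phi> (v s, v t) else 0)"

definition degree_mat :: "'a pair_pre_digraph \<Rightarrow> nat \<Rightarrow> (nat \<Rightarrow> 'a) \<Rightarrow> complex mat" where
  "degree_mat G n v =
     mat n n (\<lambda>(s, t). if s = t then of_nat (out_degree (with_proj G) (v s)) else 0)"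

definition A_alpha ::
    "real \<Rightarrow> 'a pair_pre_digraph \<Rightarrow> ('a \<times> 'a \<Rightarrow> complex) \<Rightarrow> nat \<Rightarrow> (nat \<Rightarrow> 'a) \<Rightarrow> complex mat" where
  "A_alpha \<alpha> G \<phi> n v =
     complex_of_real \<alpha> \<cdot>\<^sub>m degree_mat G n v + complex_of_real (1 - \<alpha>) \<cdot>\<^sub>m gain_adj_mat G \<phi> n v"

text \<open>
  Algebraic multiplicity, which is \<open>0\<close> if \<open>x\<close> is not an eigenvalue. For the Hermitian
  matrices above it coincides with the geometric multiplicity.
\<close>

definition eigenvalue_mult :: "complex mat \<Rightarrow> complex \<Rightarrow> nat" where
  "eigenvalue_mult A x = Polynomial.order x (char_poly A)"

text \<open>
  \<open>G\<close> is the cycle on \<open>n\<close> vertices, traversed as \<open>c 0, c 1, \<dots>, c (n - 1), c 0\<close>.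
\<close>

definition cycle_traversal :: "nat \<Rightarrow> 'a pair_pre_digraph \<Rightarrow> (nat \<Rightarrow> 'a) \<Rightarrow> bool" where
  "cycle_traversal n G c \<longleftrightarrow> 3 \<le> n \<and> bij_betw c {..<n} (pverts G) \<and>
     parcs G = (\<Union>i<n. {(c i, c (Suc i mod n)), (c (Suc i mod n), c i)})"

definition cycle_gain :: "nat \<Rightarrow> ('a \<times> 'a \<Rightarrow> complex) \<Rightarrow> (nat \<Rightarrow> 'a) \<Rightarrow> complex" where
  "cycle_gain n \<phi> c = (\<Prod>i<n. \<phi> (c i, c (Suc i mod n)))"

text \<open>
  The underlying graph is the cycle on \<open>n\<close> vertices and its gain is the real number \<open>r\<close>. A real
  gain depends neither on the starting vertex nor on the direction, so it does not matter which
  traversal is used.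
\<close>

definition cycle_with_gain ::
    "nat \<Rightarrow> 'a pair_pre_digraph \<Rightarrow> ('a \<times> 'a \<Rightarrow> complex) \<Rightarrow> real \<Rightarrow> bool" where
  "cycle_with_gain n G \<phi> r \<longleftrightarrow>
     (\<exists>c. cycle_traversal n G c \<and> cycle_gain n \<phi> c = complex_of_real r)"

definition switching_equivalent ::
    "'a pair_pre_digraph \<Rightarrow> ('a \<times> 'a \<Rightarrow> complex) \<Rightarrow> ('a \<times> 'a \<Rightarrow> complex) \<Rightarrow> bool" where
  "switching_equivalent G \<phi>\<^sub>1 \<phi>\<^sub>2 \<longleftrightarrow>
     (\<exists>\<zeta>. (\<forall>u \<in> pverts G. cmod (\<zeta> u) = 1) \<and>
          (\<forall>(i, j) \<in> parcs G. \<phi>\<^sub>1 (i, j) = inverse (\<zeta> i) * \<phi>\<^sub>2 (i, j) * \<zeta> j))"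

end

theory Submission
  imports Defs
    "Jordan_Normal_Form.Jordan_Normal_Form_Existence"
    "Jordan_Normal_Form.Jordan_Normal_Form_Uniqueness"
    "Jordan_Normal_Form.DL_Rank"
begin

text \<open>
  For a fixed \<open>\<lambda>\<close> call a function \<open>x\<close> on the vertices an eigenfunction if it satisfies the
  eigenvalue equation of \<open>A\<^sub>\<alpha>\<close> at every vertex. As \<open>A\<^sub>\<alpha>\<close> is Hermitian, the algebraic multiplicity
  \<open>m\<close> of \<open>\<lambda>\<close> is the dimension of the space of eigenfunctions
  (\<open>hermitian_eigenvalue_mult\<close>). Two consequences carry the argument: if \<open>|Z| < m\<close>, some nonzero
  eigenfunction vanishes on \<open>Z\<close> (\<open>eigenfunction_vanishing_on\<close>), and a family of eigenfunctions that
  is dual to the points of \<open>Z\<close> shows \<open>|Z| \<le> m\<close> (\<open>card_le_eigenvalue_mult\<close>).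

  \<^emph>\<open>The bound.\<close> If an eigenfunction vanishes at \<open>u\<close> and at all neighbours of \<open>u\<close> but one, the
  equation at \<open>u\<close> makes it vanish at that last neighbour as well. Start with a closed neighbourhood
  and repeatedly add all neighbours of a vertex already reached. Every round saves one vertex:
  after \<open>k\<close> rounds have covered all \<open>n\<close> vertices, \<open>n - k\<close> of them force an eigenfunction to vanish
  everywhere, so \<open>m \<le> n - k\<close>. The first round reaches at most \<open>\<Delta> + 1\<close> vertices and each later
  one at most \<open>\<Delta> - 1\<close> new ones, because the vertex whose neighbours are added already has a
  neighbour in the set. So \<open>n \<le> 2 + k(\<Delta> - 1) \<le> 2 + (n - m)(\<Delta> - 1)\<close>, which is the bound
  (\<open>mult_bound\<close>).

  \<^emph>\<open>The extremal graphs.\<close> Equality forces every round of every such process to be as large as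
  possible (\<open>mult_extremal_imp_tight\<close>). Looking at the first round, at the first two or three
  rounds, and at the last one shows that \<open>G\<close> is \<open>\<Delta>\<close>-regular and is complete if it contains a
  triangle (\<open>tight_triangle_imp_complete\<close>), is \<open>K\<^bsub>\<Delta>,\<Delta>\<^esub>\<close> if it does not and \<open>\<Delta> \<ge> 3\<close>
  (\<open>tight_triangle_free_imp_bipartite\<close>), and is a cycle if \<open>\<Delta> = 2\<close> (\<open>two_regular_imp_cycle\<close>).

  \<^emph>\<open>The eigenvalues.\<close> On \<open>K\<^sub>n\<close> the degree matrix is scalar, so \<open>A\<^sub>\<alpha>\<close> and \<open>A\<close> have the same
  eigenfunctions. On \<open>K\<^bsub>\<Delta>,\<Delta>\<^esub>\<close> the extremal multiplicity is \<open>n - 2\<close>, so any three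
  vertices support a nonzero eigenfunction; three vertices on one side give \<open>\<lambda> = \<alpha>\<Delta>\<close>, and two
  on one side with one on the other show that the columns of gains are proportional, which is
  triviality up to switching. Conversely, trivial gains leave room for \<open>n - 2\<close> independent
  differences of point masses. On a cycle the extremal multiplicity is 2. After multiplication by
  the gains along the walk, an eigenfunction becomes a solution of
  \<open>y\<^sub>i\<^sub>+\<^sub>2 = t y\<^sub>i\<^sub>+\<^sub>1 - y\<^sub>i\<close> which is multiplied by the gain \<open>\<gamma>\<close> of the cycle when \<open>i\<close> grows by
  \<open>n\<close>. If it vanishes for \<open>i = 0\<close>, it is a multiple of \<open>z\<^sup>i - z\<^sup>-\<^sup>i\<close> with \<open>t = z + 1 / z\<close>, unless \<open>z = \<plusminus>1\<close>,
  and the quasi-periodicity leaves only \<open>z = e\<^sup>i\<^sup>\<theta>\<close> with \<open>0 < \<theta> < \<pi>\<close> and \<open>\<gamma> = cos (n\<theta>) = \<plusminus>1\<close>. For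
  such \<open>\<theta>\<close> the sine waves of all phases are eigenfunctions, and they span a plane.
\<close>

section \<open>Multiplicities of eigenvalues of Hermitian matrices\<close>

definition hermitian_mat :: "complex mat \<Rightarrow> bool" where
  "hermitian_mat A \<longleftrightarrow> (\<forall>i < dim_row A. \<forall>j < dim_col A. A $$ (j, i) = cnj (A $$ (i, j)))"

lemma hermitian_mult_cscalar_prod:
  assumes A: "A \<in> carrier_mat n n" and herm: "hermitian_mat A"
    and x: "x \<in> carrier_vec n" and y: "y \<in> carrier_vec n"
  shows "(A *\<^sub>v x) \<bullet>c y = x \<bullet>c (A *\<^sub>v y)"
proof -
  have "(A *\<^sub>v x) \<bullet>c y = (\<Sum>i<n. \<Sum>j<n. A $$ (i, j) * x $ j * cnj (y $ i))"
    using A x y by (simp add: scalar_prod_def atLeast0LessThan sum_distrib_right)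
  also have "\<dots> = (\<Sum>j<n. \<Sum>i<n. A $$ (i, j) * x $ j * cnj (y $ i))"
    by (rule sum.swap)
  also have "\<dots> = (\<Sum>j<n. \<Sum>i<n. x $ j * (cnj (A $$ (j, i)) * cnj (y $ i)))"
    using A herm unfolding hermitian_mat_def
    by (intro sum.cong refl) (metis carrier_matD complex_cnj_cnj lessThan_iff mult.assoc mult.commute)
  also have "\<dots> = x \<bullet>c (A *\<^sub>v y)"
    using A x y by (simp add: scalar_prod_def atLeast0LessThan sum_distrib_left)
  finally show ?thesis .
qed

lemma char_matrix_mult_vec:
  assumes A: "(A :: 'a :: field mat) \<in> carrier_mat n n" and x: "x \<in> carrier_vec n"
  shows "char_matrix A \<mu> *\<^sub>v x = A *\<^sub>v x - \<mu> \<cdot>\<^sub>v x"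
proof -
  have "char_matrix A \<mu> *\<^sub>v x = A *\<^sub>v x + (- \<mu> \<cdot>\<^sub>m 1\<^sub>m n) *\<^sub>v x"
    using A x by (simp add: char_matrix_def add_mult_distrib_mat_vec[of _ n n])
  also have "(- \<mu> \<cdot>\<^sub>m 1\<^sub>m n) *\<^sub>v x = - \<mu> \<cdot>\<^sub>v x"
    using x by (intro eq_vecI) (auto simp: row_smult)
  finally show ?thesis using A x by auto
qed

text \<open>
  A vector \<open>y = (A - \<mu>)x\<close> in the kernel of \<open>A - \<mu>\<close> is, if nonzero, an eigenvector for \<open>\<mu>\<close>, so
  \<open>\<mu>\<close> is real; then \<open>\<langle>y, y\<rangle> = \<langle>(A - \<mu>)x, y\<rangle> = \<langle>x, (A - \<mu>)y\<rangle> = 0\<close>. Hence there are no proper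
  generalized eigenvectors.
\<close>
lemma hermitian_kernel_square:
  assumes A: "A \<in> carrier_mat n n" and herm: "hermitian_mat A" and x: "x \<in> carrier_vec n"
    and zero: "char_matrix A \<mu> *\<^sub>v (char_matrix A \<mu> *\<^sub>v x) = 0\<^sub>v n"
  shows "char_matrix A \<mu> *\<^sub>v x = 0\<^sub>v n"
proof (rule ccontr)
  define y where "y = char_matrix A \<mu> *\<^sub>v x"
  assume "char_matrix A \<mu> *\<^sub>v x \<noteq> 0\<^sub>v n"
  then have y0: "y \<noteq> 0\<^sub>v n" by (simp add: y_def)
  have y: "y \<in> carrier_vec n"
    using mult_mat_vec_carrier[OF char_matrix_closed[OF A] x] by (simp add: y_def)
  have yy: "y \<bullet>c y \<noteq> 0"
    using conjugate_square_eq_0_vec[OF y] y0 by simp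
  have "A *\<^sub>v y - \<mu> \<cdot>\<^sub>v y = 0\<^sub>v n"
    using zero char_matrix_mult_vec[OF A y] by (simp add: y_def)
  then have diff: "(A *\<^sub>v y - \<mu> \<cdot>\<^sub>v y) $ i = 0" if "i < n" for i
    using that by simp
  have Ay: "A *\<^sub>v y = \<mu> \<cdot>\<^sub>v y"
  proof (rule eq_vecI)
    fix i assume "i < dim_vec (\<mu> \<cdot>\<^sub>v y)"
    then show "(A *\<^sub>v y) $ i = (\<mu> \<cdot>\<^sub>v y) $ i"
      using diff[of i] y A by simp
  qed (use A y in auto)
  have "\<mu> * (y \<bullet>c y) = cnj \<mu> * (y \<bullet>c y)"
    using hermitian_mult_cscalar_prod[OF A herm y y] y
    by (simp add: Ay conjugate_smult_vec)
  then have real: "cnj \<mu> = \<mu>" using yy by simp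
  have y_eq: "y = A *\<^sub>v x - \<mu> \<cdot>\<^sub>v x"
    unfolding y_def by (rule char_matrix_mult_vec[OF A x])
  have "y \<bullet>c y = (A *\<^sub>v x) \<bullet>c y - (\<mu> \<cdot>\<^sub>v x) \<bullet>c y"
    using A x y by (subst (1) y_eq) (intro minus_scalar_prod_distrib, auto)
  also have "\<dots> = 0"
    using A x y hermitian_mult_cscalar_prod[OF A herm x y]
    by (simp add: Ay conjugate_smult_vec real)
  finally show False using yy by simp
qed

lemma hermitian_kernel_pow:
  assumes A: "A \<in> carrier_mat n n" and herm: "hermitian_mat A"
  shows "mat_kernel (char_matrix A \<mu> ^\<^sub>m Suc k) = mat_kernel (char_matrix A \<mu>)"
proof
  let ?N = "char_matrix A \<mu>"
  have N: "?N \<in> carrier_mat n n" using A by simp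
  have pow: "?N ^\<^sub>m k \<in> carrier_mat n n" for k using N by simp
  show "mat_kernel (?N ^\<^sub>m Suc k) \<subseteq> mat_kernel ?N"
  proof
    fix x assume ker: "x \<in> mat_kernel (?N ^\<^sub>m Suc k)"
    have x: "x \<in> carrier_vec n" by (rule mat_kernelD(1)[OF pow ker])
    have "?N ^\<^sub>m Suc k *\<^sub>v x = 0\<^sub>v n" by (rule mat_kernelD(2)[OF pow ker])
    with x have "?N *\<^sub>v x = 0\<^sub>v n"
    proof (induction k arbitrary: x)
      case 0
      then show ?case using N by simp
    next
      case (Suc k)
      have "?N ^\<^sub>m Suc k *\<^sub>v (?N *\<^sub>v x) = 0\<^sub>v n"
        using Suc.prems(2) unfolding pow_mat.simps(2)[of _ "Suc k"] assoc_mult_mat_vec[OF pow[of "Suc k"] N Suc.prems(1)] .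
      then have "?N *\<^sub>v (?N *\<^sub>v x) = 0\<^sub>v n"
        by (rule Suc.IH[OF mult_mat_vec_carrier[OF N Suc.prems(1)]])
      then show ?case
        by (rule hermitian_kernel_square[OF A herm Suc.prems(1)])
    qed
    then show "x \<in> mat_kernel ?N" by (rule mat_kernelI[OF N x])
  qed
  show "mat_kernel ?N \<subseteq> mat_kernel (?N ^\<^sub>m Suc k)"
    unfolding pow_mat.simps by (rule mat_kernel_mult_subset[OF N pow])
qed

text \<open>
  The algebraic multiplicity is the sum of the sizes of the Jordan blocks for \<open>\<mu>\<close>, that is the
  dimension of the kernel of a high power of \<open>A - \<mu>\<close>, and for a Hermitian matrix the powers have the
  same kernel as \<open>A - \<mu>\<close> itself.
\<close>
lemma hermitian_eigenvalue_mult: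
  assumes A: "A \<in> carrier_mat n n" and herm: "hermitian_mat A"
  shows "eigenvalue_mult A \<mu> = kernel_dim (char_matrix A \<mu>)"
proof -
  obtain as where "char_poly A = (\<Prod>a \<leftarrow> as. [:- a, 1:])"
    using char_poly_factorized[OF A] by auto
  then obtain n_as where jnf: "jordan_nf A n_as"
    using jordan_nf_exists[OF A] by blast
  let ?N = "char_matrix A \<mu>"
  define sizes where "sizes = map fst (filter (\<lambda>na. snd na = \<mu>) n_as)"
  define k where "k = Suc (sum_list sizes)"
  have "eigenvalue_mult A \<mu> = sum_list sizes"
    unfolding eigenvalue_mult_def sizes_def by (rule jordan_nf_order[OF jnf])
  also have "\<dots> = (\<Sum>s \<leftarrow> sizes. min k s)"
  proof -
    \<comment> \<open>The exponent \<open>k\<close> exceeds the size of every Jordan block for \<open>\<mu>\<close>.\<close>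
    have "map (min k) sizes = map id sizes"
      using member_le_sum_list[of _ sizes] by (intro map_cong) (fastforce simp: k_def)+
    then show ?thesis by simp
  qed
  also have "\<dots> = dim_gen_eigenspace A \<mu> k"
    by (simp add: dim_gen_eigenspace[OF jnf] sizes_def case_prod_unfold)
  also have "\<dots> = kernel_dim ?N"
    using hermitian_kernel_pow[OF A herm, of \<mu> "sum_list sizes"] A pow_carrier_mat[of ?N n k]
    unfolding dim_gen_eigenspace_def kernel_dim_def k_def by simp
  finally show ?thesis .
qed

section \<open>Kernel dimension through vanishing sets and dual families\<close>

text \<open>
  Fewer equations than unknowns: filling the system up with zero rows gives a square matrix of
  determinant 0.
\<close>
lemma wide_system_nontrivial_solution:
  fixes f :: "nat \<Rightarrow> 'b \<Rightarrow> complex"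
  assumes fin: "finite Z" and less: "card Z < m"
  shows "\<exists>c. c \<in> carrier_vec m \<and> c \<noteq> 0\<^sub>v m \<and> (\<forall>z\<in>Z. (\<Sum>j<m. f j z * c $ j) = 0)"
proof -
  obtain e where e: "bij_betw e {..<card Z} Z"
    using ex_bij_betw_nat_finite[OF fin] by (auto simp: atLeast0LessThan)
  define M where "M = mat m m (\<lambda>(i, j). if i < card Z then f j (e i) else 0)"
  have M: "M \<in> carrier_mat m m" by (simp add: M_def)
  have "det M = det (mat\<^sub>r m m (\<lambda>i. if i = card Z then 0\<^sub>v m else row M i))"
    by (rule arg_cong[of _ _ det]) (auto simp: M_def intro!: eq_matI)
  also have "\<dots> = 0"
    using M by (intro det_row_0[OF less]) auto
  finally obtain c where c: "c \<in> carrier_vec m" "c \<noteq> 0\<^sub>v m" "M *\<^sub>v c = 0\<^sub>v m"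
    using det_0_iff_vec_prod_zero_field[OF M] by blast
  have "(\<Sum>j<m. f j z * c $ j) = 0" if z: "z \<in> Z" for z
  proof -
    obtain i where i: "i < card Z" "z = e i"
      using e z by (auto simp: bij_betw_def)
    have "(\<Sum>j<m. f j z * c $ j) = (M *\<^sub>v c) $ i"
      using i less c(1) by (simp add: M_def scalar_prod_def atLeast0LessThan)
    then show ?thesis using c(3) i less by simp
  qed
  then show ?thesis using c by blast
qed

text \<open>
  Vanishing on \<open>Z\<close> imposes \<open>|Z|\<close> linear conditions on the coefficients of a kernel vector with
  respect to a basis of the kernel.
\<close>
lemma kernel_vector_vanishing_on:
  fixes N :: "complex mat"
  assumes N: "N \<in> carrier_mat n n" and Z: "Z \<subseteq> {..<n}" and less: "card Z < kernel_dim N"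
  shows "\<exists>x \<in> carrier_vec n. x \<noteq> 0\<^sub>v n \<and> N *\<^sub>v x = 0\<^sub>v n \<and> (\<forall>z\<in>Z. x $ z = 0)"
proof -
  interpret K: kernel n n N by (unfold_locales, rule N)
  obtain B where "finite B" "K.basis B"
    using kernel_basis_exists[OF N] by auto
  then have cardB: "card B = kernel_dim N" and B: "B \<subseteq> mat_kernel N" and indpt: "K.lin_indpt B"
    using K.Ker.dim_basis by (auto simp: K.Ker.basis_def)
  obtain bs where bs: "set bs = B" "distinct bs"
    using finite_distinct_list[OF \<open>finite B\<close>] by auto
  define m where "m = length bs"
  have m: "m = kernel_dim N"
    using cardB bs distinct_card m_def by fastforce
  have Bc: "B \<subseteq> carrier_vec n" and Bker: "\<And>b. b \<in> B \<Longrightarrow> N *\<^sub>v b = 0\<^sub>v n"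
    using B mat_kernel[OF N] by auto
  obtain c where c: "c \<in> carrier_vec m" "c \<noteq> 0\<^sub>v m"
    and cZ: "\<forall>z\<in>Z. (\<Sum>j<m. bs ! j $ z * c $ j) = 0"
    using wide_system_nontrivial_solution[of Z m "\<lambda>j z. bs ! j $ z"] less m Z finite_subset[OF Z]
    by auto
  define C where "C = mat_of_cols n bs"
  have C: "C \<in> carrier_mat n m" by (simp add: C_def m_def)
  have colsC: "cols C = bs" unfolding C_def using bs Bc by (intro cols_mat_of_cols) auto
  have bsc: "bs ! j \<in> carrier_vec n" "N *\<^sub>v (bs ! j) = 0\<^sub>v n" if "j < m" for j
    using that Bc Bker bs nth_mem[of j bs] by (auto simp: m_def)
  define x where "x = C *\<^sub>v c"
  have xc: "x \<in> carrier_vec n" using C c by (simp add: x_def)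
  have entry: "x $ i = (\<Sum>j<m. bs ! j $ i * c $ j)" if "i < n" for i
    using that C c bsc
    by (auto simp: x_def scalar_prod_def atLeast0LessThan C_def m_def mat_of_cols_index
        intro!: sum.cong)
  have "x \<noteq> 0\<^sub>v n"
  proof
    assume "x = 0\<^sub>v n"
    then have "K.NC.lin_dep B"
      using K.NC.lin_depI[OF C c] bs colsC by (simp add: x_def)
    then show False using K.lindep_same[OF B] indpt by simp
  qed
  moreover have "N *\<^sub>v x = 0\<^sub>v n"
  proof -
    have "N * C = 0\<^sub>m n m"
    proof (rule eq_matI)
      fix i j assume ij: "i < dim_row (0\<^sub>m n m)" "j < dim_col (0\<^sub>m n m)"
      have "col C j = bs ! j" using ij C colsC cols_nth[of j C] by simp
      then have "(N * C) $$ (i, j) = (N *\<^sub>v (bs ! j)) $ i"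
        using ij N C by simp
      then show "(N * C) $$ (i, j) = 0\<^sub>m n m $$ (i, j)" using bsc ij by simp
    qed (use N C in auto)
    then show ?thesis
    proof -
      have "0\<^sub>m n m *\<^sub>v c = 0\<^sub>v n" using c(1) by (intro eq_vecI) auto
      then show ?thesis using \<open>N * C = 0\<^sub>m n m\<close> assoc_mult_mat_vec[OF N C c(1)] by (simp add: x_def)
    qed
  qed
  moreover have "\<forall>z\<in>Z. x $ z = 0"
    using cZ entry Z by auto
  ultimately show ?thesis using xc by blast
qed

lemma card_le_kernel_dim:
  fixes N :: "complex mat"
  assumes N: "N \<in> carrier_mat n n" and Z: "Z \<subseteq> {..<n}"
    and dual: "\<And>z. z \<in> Z \<Longrightarrow> \<exists>x \<in> carrier_vec n. N *\<^sub>v x = 0\<^sub>v n \<and> x $ z = 1 \<and>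
      (\<forall>z' \<in> Z - {z}. x $ z' = 0)"
  shows "card Z \<le> kernel_dim N"
proof -
  interpret K: kernel n n N by (unfold_locales, rule N)
  have finZ: "finite Z" using Z finite_subset by auto
  obtain B where "finite B" "K.basis B"
    using kernel_basis_exists[OF N] by auto
  then have fd: "K.Ker.fin_dim"
    by (auto simp: K.Ker.basis_def K.Ker.fin_dim_def)
  obtain x where x: "\<And>z. z \<in> Z \<Longrightarrow> x z \<in> carrier_vec n" "\<And>z. z \<in> Z \<Longrightarrow> N *\<^sub>v x z = 0\<^sub>v n"
    "\<And>z. z \<in> Z \<Longrightarrow> x z $ z = 1" "\<And>z z'. z \<in> Z \<Longrightarrow> z' \<in> Z - {z} \<Longrightarrow> x z $ z' = 0"
    using dual by metis
  have inj: "inj_on x Z"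
    by (rule inj_onI) (metis DiffI insert_absorb insert_iff singletonD x(3,4) zero_neq_one)
  have sub: "x ` Z \<subseteq> mat_kernel N"
    using x(1,2) by (auto intro: mat_kernelI[OF N])
  have "K.lin_indpt (x ` Z)"
  proof
    assume "K.lin_dep (x ` Z)"
    then obtain a b where lc: "K.lincomb a (x ` Z) = 0\<^sub>v n" and b: "b \<in> x ` Z" "a b \<noteq> 0"
      using K.Ker.finite_lin_dep[OF finite_imageI[OF finZ, of x]] sub by metis
    then obtain z where z: "z \<in> Z" "b = x z" by auto
    have "0 = K.lincomb a (x ` Z) $ z" using lc z Z by auto
    also have "\<dots> = (\<Sum>y \<in> x ` Z. a y * y $ z)"
      using z Z sub by (intro K.lincomb_index) auto
    also have "\<dots> = (\<Sum>z' \<in> Z. a (x z') * x z' $ z)"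
      using inj by (simp add: sum.reindex)
    also have "\<dots> = (\<Sum>z' \<in> Z. if z' = z then a (x z) else 0)"
      using x(3,4) z by (intro sum.cong) auto
    also have "\<dots> = a b" using z finZ by simp
    finally show False using b by simp
  qed
  then have "card (x ` Z) \<le> K.dim"
    using K.Ker.li_le_dim(2)[OF fd] sub by simp
  then show ?thesis using card_image[OF inj] by simp
qed

section \<open>Eigenfunctions on the vertices\<close>

definition (in pair_pre_digraph) nbrs :: "'a \<Rightarrow> 'a set" where
  "nbrs u = {w. (u, w) \<in> parcs G}"

context pair_graph
begin

lemma nbrs_subset: "nbrs u \<subseteq> pverts G"
  by (auto simp: nbrs_def dest: in_arcsD2)

lemma finite_nbrs [simp]: "finite (nbrs u)"
  using nbrs_subset pair_finite_verts finite_subset by blast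

lemma nbrs_sym: "w \<in> nbrs u \<longleftrightarrow> u \<in> nbrs w"
  using arcs_symmetric by (auto simp: nbrs_def)

lemma not_own_nbr [simp]: "u \<notin> nbrs u"
  using no_loops' by (auto simp: nbrs_def)

lemma out_degree_eq_card_nbrs: "out_degree (with_proj G) u = card (nbrs u)"
proof -
  have "out_arcs (with_proj G) u = Pair u ` nbrs u"
    by (auto simp: nbrs_def out_arcs_def)
  then show ?thesis by (simp add: out_degree_def card_image inj_on_def)
qed

end

context gain_graph
begin

lemma gain_swap: "w \<in> nbrs u \<Longrightarrow> \<phi> (w, u) = cnj (\<phi> (u, w))"
proof -
  assume w: "w \<in> nbrs u"
  then have "\<phi> (u, w) * cnj (\<phi> (u, w)) = 1"
    using gain_unit[of "(u, w)"] complex_norm_square[of "\<phi> (u, w)"] by (simp add: nbrs_def)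
  moreover have "\<phi> (w, u) = inverse (\<phi> (u, w))"
    using w nbrs_sym by (intro gain_inverse) (auto simp: nbrs_def)
  ultimately show ?thesis by (simp add: inverse_unique)
qed

lemma gain_nonzero: "w \<in> nbrs u \<Longrightarrow> \<phi> (u, w) \<noteq> 0"
  using gain_unit[of "(u, w)"] by (auto simp: nbrs_def)

definition eigenfunction :: "real \<Rightarrow> complex \<Rightarrow> ('a \<Rightarrow> complex) \<Rightarrow> bool" where
  "eigenfunction \<alpha> lam x \<longleftrightarrow> (\<forall>u \<in> pverts G.
     of_real \<alpha> * of_nat (card (nbrs u)) * x u + of_real (1 - \<alpha>) * (\<Sum>w\<in>nbrs u. \<phi> (u, w) * x w)
       = lam * x u)"

end

locale enumerated_gain_graph = gain_graph G \<phi> for G :: "'a pair_pre_digraph" and \<phi> +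
  fixes n :: nat and v :: "nat \<Rightarrow> 'a"
  assumes enum: "bij_betw v {..<n} (pverts G)"
begin

lemma card_verts: "card (pverts G) = n"
  using bij_betw_same_card[OF enum] by simp

lemma A_alpha_carrier: "A_alpha \<alpha> G \<phi> n v \<in> carrier_mat n n"
  by (simp add: A_alpha_def degree_mat_def gain_adj_mat_def)

lemma A_alpha_hermitian: "hermitian_mat (A_alpha \<alpha> G \<phi> n v)"
proof -
  have "A_alpha \<alpha> G \<phi> n v $$ (j, i) = cnj (A_alpha \<alpha> G \<phi> n v $$ (i, j))" if "i < n" "j < n" for i j
  proof (cases "v j \<in> nbrs (v i)")
    case True
    then have "v i \<in> nbrs (v j)" using nbrs_sym by blast
    then show ?thesis
      using that True gain_swap[OF True]
      by (auto simp: A_alpha_def degree_mat_def gain_adj_mat_def nbrs_def)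
  next
    case False
    then have "v i \<notin> nbrs (v j)" using nbrs_sym by blast
    then show ?thesis
      using that False by (auto simp: A_alpha_def degree_mat_def gain_adj_mat_def nbrs_def)
  qed
  then show ?thesis
    unfolding hermitian_mat_def carrier_matD[OF A_alpha_carrier] by blast
qed

text \<open>
  The bridge from vectors indexed by the enumeration of the vertices to functions on the vertices,
  with which the graph-theoretic arguments work.
\<close>
lemma char_matrix_kernel_iff_eigenfunction:
  "char_matrix (A_alpha \<alpha> G \<phi> n v) lam *\<^sub>v vec n (x \<circ> v) = 0\<^sub>v n \<longleftrightarrow> eigenfunction \<alpha> lam x"
proof -
  let ?A = "A_alpha \<alpha> G \<phi> n v"
  have entry: "(?A *\<^sub>v vec n (x \<circ> v)) $ s = of_real \<alpha> * of_nat (card (nbrs (v s))) * x (v s)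
      + of_real (1 - \<alpha>) * (\<Sum>w\<in>nbrs (v s). \<phi> (v s, w) * x w)" if s: "s < n" for s
  proof -
    have "(?A *\<^sub>v vec n (x \<circ> v)) $ s = (\<Sum>t<n. ?A $$ (s, t) * x (v t))"
      using s A_alpha_carrier[of \<alpha>] by (simp add: scalar_prod_def atLeast0LessThan)
    also have "\<dots> = (\<Sum>t<n. (if s = t then of_real \<alpha> * of_nat (card (nbrs (v s))) * x (v s) else 0)
        + of_real (1 - \<alpha>) * (if v t \<in> nbrs (v s) then \<phi> (v s, v t) * x (v t) else 0))"
      using s by (intro sum.cong refl)
        (auto simp: A_alpha_def degree_mat_def gain_adj_mat_def nbrs_def
          out_degree_eq_card_nbrs[unfolded nbrs_def] algebra_simps)
    also have "\<dots> = of_real \<alpha> * of_nat (card (nbrs (v s))) * x (v s)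
        + of_real (1 - \<alpha>) * (\<Sum>t<n. if v t \<in> nbrs (v s) then \<phi> (v s, v t) * x (v t) else 0)"
      using s by (simp add: sum.distrib sum_distrib_left)
    also have "(\<Sum>t<n. if v t \<in> nbrs (v s) then \<phi> (v s, v t) * x (v t) else 0)
        = (\<Sum>w\<in>pverts G. if w \<in> nbrs (v s) then \<phi> (v s, w) * x w else 0)"
      by (rule sum.reindex_bij_betw[OF enum])
    also have "\<dots> = (\<Sum>w\<in>nbrs (v s). \<phi> (v s, w) * x w)"
      using nbrs_subset[of "v s"] pair_finite_verts
      by (simp add: sum.If_cases Int_absorb1 Collect_mem_eq)
    finally show ?thesis .
  qed
  have "char_matrix ?A lam *\<^sub>v vec n (x \<circ> v) = 0\<^sub>v n
      \<longleftrightarrow> (\<forall>s<n. (?A *\<^sub>v vec n (x \<circ> v)) $ s = lam * x (v s))"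
    using A_alpha_carrier[of \<alpha>] 
    by (simp add: char_matrix_mult_vec[of _ n] vec_eq_iff)
  also have "\<dots> \<longleftrightarrow> eigenfunction \<alpha> lam x"
  proof -
    have "pverts G = v ` {..<n}" using enum by (simp add: bij_betw_def)
    then show ?thesis by (simp add: eigenfunction_def entry Ball_def image_iff) blast
  qed
  finally show ?thesis .
qed

lemma eigenfunction_vanishing_on:
  assumes Z: "Z \<subseteq> pverts G" and less: "card Z < eigenvalue_mult (A_alpha \<alpha> G \<phi> n v) lam"
  obtains x where "eigenfunction \<alpha> lam x" "\<And>z. z \<in> Z \<Longrightarrow> x z = 0" "\<exists>u \<in> pverts G. x u \<noteq> 0"
proof -
  let ?N = "char_matrix (A_alpha \<alpha> G \<phi> n v) lam"
  define v' where "v' = the_inv_into {..<n} v"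
  have inv: "v' (v s) = s" if "s < n" for s
    using enum that by (auto simp: v'_def bij_betw_def the_inv_into_f_f)
  have v': "v' u < n" "v (v' u) = u" if u: "u \<in> pverts G" for u
  proof -
    obtain s where "s < n" "u = v s" using enum u by (auto simp: bij_betw_def)
    then show "v' u < n" "v (v' u) = u" using inv by auto
  qed
  have "card (v' ` Z) < kernel_dim ?N"
    using less card_image_le[of Z v'] finite_subset[OF Z pair_finite_verts]
    by (simp add: hermitian_eigenvalue_mult[OF A_alpha_carrier A_alpha_hermitian])
  moreover have "v' ` Z \<subseteq> {..<n}" using Z v' by auto
  ultimately obtain y where y: "y \<in> carrier_vec n" "y \<noteq> 0\<^sub>v n" "?N *\<^sub>v y = 0\<^sub>v n"
      "\<forall>z \<in> v' ` Z. y $ z = 0"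
    using kernel_vector_vanishing_on[OF char_matrix_closed[OF A_alpha_carrier]] by metis
  define x where "x u = y $ v' u" for u
  have yx: "y = vec n (x \<circ> v)" using y(1) inv by (auto simp: x_def)
  show ?thesis
  proof
    show "eigenfunction \<alpha> lam x"
      using y(3) char_matrix_kernel_iff_eigenfunction by (simp add: yx)
    show "x z = 0" if "z \<in> Z" for z using y(4) that by (auto simp: x_def)
    obtain s where s: "s < n" "y $ s \<noteq> 0"
      using y(1,2) by (metis carrier_vecD eq_vecI index_zero_vec)
    then have "v s \<in> pverts G" "x (v s) \<noteq> 0"
      using inv enum by (auto simp: x_def bij_betw_def)
    then show "\<exists>u \<in> pverts G. x u \<noteq> 0" by blast
  qed
qed

lemma card_le_eigenvalue_mult:
  assumes Z: "Z \<subseteq> pverts G"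
    and dual: "\<And>z. z \<in> Z \<Longrightarrow> \<exists>x. eigenfunction \<alpha> lam x \<and> x z = 1 \<and> (\<forall>z' \<in> Z - {z}. x z' = 0)"
  shows "card Z \<le> eigenvalue_mult (A_alpha \<alpha> G \<phi> n v) lam"
proof -
  let ?N = "char_matrix (A_alpha \<alpha> G \<phi> n v) lam"
  define I where "I = {s. s < n \<and> v s \<in> Z}"
  have inj: "inj_on v {..<n}" and Zimg: "Z = v ` I"
    using enum Z by (auto simp: bij_betw_def I_def)
  have "card I \<le> kernel_dim ?N"
  proof (rule card_le_kernel_dim)
    show "?N \<in> carrier_mat n n" by (rule char_matrix_closed[OF A_alpha_carrier])
    show "I \<subseteq> {..<n}" by (auto simp: I_def)
    fix i assume i: "i \<in> I"
    then obtain x where x: "eigenfunction \<alpha> lam x" "x (v i) = 1" "\<forall>z' \<in> Z - {v i}. x z' = 0"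
      using dual[of "v i"] by (auto simp: I_def)
    have "\<forall>j \<in> I - {i}. v j \<in> Z - {v i}"
      using i inj by (auto simp: I_def inj_on_def)
    then show "\<exists>y \<in> carrier_vec n. ?N *\<^sub>v y = 0\<^sub>v n \<and> y $ i = 1 \<and> (\<forall>z' \<in> I - {i}. y $ z' = 0)"
      using i x char_matrix_kernel_iff_eigenfunction[of \<alpha> lam x]
      by (intro bexI[of _ "vec n (x \<circ> v)"]) (auto simp: I_def)
  qed
  moreover have "card Z = card I"
    unfolding Zimg by (rule card_image) (auto intro: inj_on_subset[OF inj] simp: I_def)
  ultimately show ?thesis
    by (simp add: hermitian_eigenvalue_mult[OF A_alpha_carrier A_alpha_hermitian])
qed

lemma eigenvalue_mult_cong:
  assumes "\<And>x. eigenfunction \<alpha> lam x \<longleftrightarrow> eigenfunction \<beta> \<kappa> x"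
  shows "eigenvalue_mult (A_alpha \<alpha> G \<phi> n v) lam = eigenvalue_mult (A_alpha \<beta> G \<phi> n v) \<kappa>"
proof -
  have as_function: "\<exists>x. y = vec n (x \<circ> v)" if y: "y \<in> carrier_vec n" for y :: "complex vec"
  proof
    have "the_inv_into {..<n} v (v s) = s" if "s < n" for s
      using enum that by (auto simp: bij_betw_def the_inv_into_f_f)
    then show "y = vec n ((\<lambda>u. y $ the_inv_into {..<n} v u) \<circ> v)" using y by auto
  qed
  have "mat_kernel (char_matrix (A_alpha \<alpha> G \<phi> n v) lam)
      = mat_kernel (char_matrix (A_alpha \<beta> G \<phi> n v) \<kappa>)"
    unfolding mat_kernel[OF char_matrix_closed[OF A_alpha_carrier]]
    using as_function assms char_matrix_kernel_iff_eigenfunction by (metis (no_types, lifting))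
  then show ?thesis
    using char_matrix_closed[OF A_alpha_carrier, THEN carrier_matD(2)]
    by (simp add: hermitian_eigenvalue_mult[OF A_alpha_carrier A_alpha_hermitian] kernel_dim_def)
qed

end

section \<open>Growing a vertex set by neighbourhoods\<close>

locale max_degree_graph = pair_graph G for G :: "'a pair_pre_digraph" +
  fixes D :: nat
  assumes connected: "Digraph_Component.connected (with_proj G)"
    and degree_le: "u \<in> pverts G \<Longrightarrow> card (nbrs u) \<le> D"
    and degree_attained: "\<exists>u \<in> pverts G. card (nbrs u) = D"
    and D_ge_2: "2 \<le> D"
begin

text \<open>
  The form in which connectedness is used.
\<close>
lemma nbr_closed_eq_verts:
  assumes S: "S \<subseteq> pverts G" "S \<noteq> {}" and closed: "\<And>u. u \<in> S \<Longrightarrow> nbrs u \<subseteq> S"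
  shows "S = pverts G"
proof -
  obtain s where s: "s \<in> S" using S by auto
  have "w \<in> S" if w: "w \<in> pverts G" for w
  proof -
    have "strongly_connected (with_proj G)"
      using symmetric_connected_imp_strongly_connected[OF pair_sym_arcs connected] .
    then have "s \<rightarrow>\<^sup>*\<^bsub>with_proj G\<^esub> w" using s S w by (auto simp: strongly_connected_def)
    then show ?thesis
    proof (induction rule: reachable_induct)
      case base
      then show ?case using s by simp
    next
      case (step x y)
      then show ?case using closed[of x] by (auto simp: nbrs_def)
    qed
  qed
  then show ?thesis using S by blast
qed

lemma nbrs_nonempty:
  assumes u: "u \<in> pverts G"
  shows "nbrs u \<noteq> {}"
proof
  assume "nbrs u = {}"
  then have V: "pverts G = {u}" using u by (intro nbr_closed_eq_verts[symmetric]) auto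
  obtain w where w: "w \<in> pverts G" "card (nbrs w) = D" using degree_attained by auto
  then have "nbrs w \<subseteq> {w}" using nbrs_subset[of w] V by simp
  then have "nbrs w = {}" using not_own_nbr by blast
  then show False using w D_ge_2 by simp
qed

text \<open>
  The index counts the eigenvalue equations spent: each round uses the equation at one vertex. Rounds
  that reach nothing new are excluded, because their equations would determine no further value.
\<close>
inductive grown :: "'a set \<Rightarrow> nat \<Rightarrow> bool" where
  start: "u \<in> pverts G \<Longrightarrow> grown (insert u (nbrs u)) 1"
| step: "grown W k \<Longrightarrow> u \<in> W \<Longrightarrow> \<not> nbrs u \<subseteq> W \<Longrightarrow> grown (W \<union> nbrs u) (Suc k)"

lemma grown_subset: "grown W k \<Longrightarrow> W \<subseteq> pverts G"
  by (induction rule: grown.induct) (use nbrs_subset in auto)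

lemma finite_grown: "grown W k \<Longrightarrow> finite W"
  using grown_subset pair_finite_verts finite_subset by blast

lemma grown_nonempty: "grown W k \<Longrightarrow> W \<noteq> {}"
  by (induction rule: grown.induct) auto

lemma grown_meets_nbrs: "grown W k \<Longrightarrow> u \<in> W \<Longrightarrow> nbrs u \<inter> W \<noteq> {}"
proof (induction arbitrary: u rule: grown.induct)
  case (start s)
  show ?case
  proof (cases "u = s")
    case True
    then show ?thesis using nbrs_nonempty start by auto
  next
    case False
    then have "s \<in> nbrs u" using start nbrs_sym by blast
    then show ?thesis by auto
  qed
next
  case (step W k s)
  show ?case
  proof (cases "u \<in> W")
    case False
    then have "s \<in> nbrs u" using step nbrs_sym by blast
    then show ?thesis using step by auto
  qed (use step in auto)
qed

lemma card_grow:
  assumes "grown W k"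
  shows "card (W \<union> nbrs u) + card (nbrs u \<inter> W) = card W + card (nbrs u)"
  using card_Un_Int[of W "nbrs u"] finite_grown[OF assms] by (simp add: Int_commute)

text \<open>
  The vertex \<open>u\<close> has a neighbour inside the grown set, so at most \<open>D - 1\<close> of its neighbours are new.
\<close>
lemma card_grow_le:
  assumes W: "grown W k" "u \<in> W"
  shows "card (W \<union> nbrs u) \<le> card W + (D - 1)"
proof -
  have "card (nbrs u \<inter> W) \<ge> 1"
    using grown_meets_nbrs[OF W] by (simp add: Suc_le_eq card_gt_0_iff)
  moreover have "card (nbrs u) \<le> D" using W grown_subset degree_le by blast
  ultimately show ?thesis using card_grow[OF W(1), of u] by linarith
qed

lemma card_grown_le: "grown W k \<Longrightarrow> card W \<le> 2 + k * (D - 1)"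
proof (induction rule: grown.induct)
  case (start u)
  then have "card (insert u (nbrs u)) \<le> Suc D" using degree_le[OF start] by simp
  then show ?case using D_ge_2 by simp
next
  case (step W k u)
  then show ?case using card_grow_le[of W k u] by simp
qed

lemma grown_proper_extends:
  assumes W: "grown W k" and proper: "W \<noteq> pverts G"
  obtains u where "u \<in> W" "\<not> nbrs u \<subseteq> W"
  using nbr_closed_eq_verts[OF grown_subset[OF W] grown_nonempty[OF W]] proper by blast

text \<open>
  By connectedness the growth only stops at the whole graph.
\<close>
lemma grown_exhausts:
  assumes "grown W k"
  shows "\<exists>k' \<ge> k. grown (pverts G) k' \<and> card (pverts G) \<le> card W + (k' - k) * (D - 1)"
  using assms
proof (induction "card (pverts G - W)" arbitrary: W k rule: less_induct)
  case less
  show ?case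
  proof (cases "W = pverts G")
    case True
    then show ?thesis using less.prems by auto
  next
    case False
    then obtain u where u: "u \<in> W" "\<not> nbrs u \<subseteq> W"
      using grown_proper_extends less.prems by blast
    let ?W = "W \<union> nbrs u"
    have "pverts G - ?W \<subset> pverts G - W" using u nbrs_subset by auto
    then have "card (pverts G - ?W) < card (pverts G - W)"
      using pair_finite_verts by (simp add: psubset_card_mono)
    from less.hyps[OF this grown.step[OF less.prems u]]
    obtain k' where k': "Suc k \<le> k'" "grown (pverts G) k'"
      "card (pverts G) \<le> card ?W + (k' - Suc k) * (D - 1)" by blast
    have "card ?W + (k' - Suc k) * (D - 1) \<le> card W + (D - 1) + (k' - Suc k) * (D - 1)"
      using card_grow_le[OF less.prems u(1)] by simp
    also have "\<dots> = card W + Suc (k' - Suc k) * (D - 1)" by simp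
    also have "Suc (k' - Suc k) = k' - k" using k' by simp
    finally show ?thesis using k' by (intro exI[of _ k']) auto
  qed
qed

text \<open>
  Every growing process adds the maximal number of vertices in each round.
\<close>
definition tight :: bool where
  "tight \<longleftrightarrow> (\<forall>W k. grown W k \<longrightarrow> card W = 2 + k * (D - 1))"

text \<open>
  Any process can be continued until it exhausts the graph, and a deficit in one round could never
  be made up for later.
\<close>
lemma tightI:
  assumes "\<And>k. grown (pverts G) k \<Longrightarrow> card (pverts G) = 2 + k * (D - 1)"
  shows tight
  unfolding tight_def
proof (intro allI impI)
  fix W k assume W: "grown W k"
  obtain k' where k': "k \<le> k'" "grown (pverts G) k'"
    "card (pverts G) \<le> card W + (k' - k) * (D - 1)"
    using grown_exhausts[OF W] by blast
  have "k' * (D - 1) = k * (D - 1) + (k' - k) * (D - 1)"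
    using k'(1) by (metis add_mult_distrib le_add_diff_inverse)
  then show "card W = 2 + k * (D - 1)"
    using card_grown_le[OF W] assms[OF k'(2)] k'(3) by linarith
qed

context
  assumes tight: tight
begin

lemma tight_regular:
  assumes "u \<in> pverts G"
  shows "card (nbrs u) = D"
  using tight grown.start[OF assms] D_ge_2 by (fastforce simp: tight_def)

text \<open>
  Reaching \<open>D - 1\<close> new vertices from a vertex of degree \<open>D\<close> leaves room for a single old neighbour.
  Together with regularity, this is all that the classification below needs to know about \<open>tight\<close>.
\<close>
lemma tight_one_old_nbr:
  assumes W: "grown W k" "u \<in> W" and new: "\<not> nbrs u \<subseteq> W"
  shows "card (nbrs u \<inter> W) = 1"
proof -
  have "card W = 2 + k * (D - 1)" "card (W \<union> nbrs u) = 2 + Suc k * (D - 1)"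
    using tight W(1) grown.step[OF W new] unfolding tight_def by blast+
  moreover have "card (nbrs u) = D" using tight_regular W grown_subset by blast
  ultimately show ?thesis using card_grow[OF W(1), of u] D_ge_2 by simp
qed

text \<open>
  Grow from \<open>u\<close>. A neighbour \<open>w\<close> with a neighbour outside the closed neighbourhood of \<open>u\<close> has \<open>u\<close> as its
  only old neighbour, so a common neighbour of \<open>u\<close> and \<open>w\<close> makes them
  twins: vertices with the same closed neighbourhood.
\<close>
lemma tight_edge:
  assumes u: "u \<in> pverts G" and w: "w \<in> nbrs u" and common: "nbrs u \<inter> nbrs w \<noteq> {}"
  shows "nbrs w = insert u (nbrs u) - {w}"
proof -
  let ?T = "insert u (nbrs u)"
  have "nbrs w \<subseteq> ?T"
  proof (rule ccontr)
    assume "\<not> nbrs w \<subseteq> ?T"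
    then have "card (nbrs w \<inter> ?T) = 1"
      using tight_one_old_nbr[OF grown.start[OF u]] w by simp
    moreover have "u \<in> nbrs w \<inter> ?T" using w nbrs_sym by auto
    ultimately have "nbrs w \<inter> ?T = {u}" by (metis card_1_singletonE singletonD)
    moreover obtain c where c: "c \<in> nbrs u" "c \<in> nbrs w" using common by blast
    ultimately have "c \<in> {u}" by (metis IntI insertI2)
    then have "u \<in> nbrs u" using c(1) by simp
    then show False by simp
  qed
  then have "nbrs w \<subseteq> ?T - {w}" using not_own_nbr[of w] by blast
  moreover have "card (?T - {w}) = card (nbrs w)"
    using w u tight_regular nbrs_subset[of u] by (auto simp: card_Diff_singleton)
  ultimately show ?thesis by (simp add: card_subset_eq)
qed

text \<open>
  The neighbour \<open>w\<close> is a twin of \<open>u\<close>, so any further neighbour of \<open>u\<close> has \<open>w\<close> as a common neighbour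
  with \<open>u\<close> and is a twin of \<open>u\<close> as well. So no edge leaves the closed neighbourhood of \<open>u\<close>.
\<close>
lemma tight_triangle_imp_complete:
  assumes u: "u \<in> pverts G" and w: "w \<in> nbrs u" and common: "nbrs u \<inter> nbrs w \<noteq> {}"
  shows "\<forall>y \<in> pverts G. nbrs y = pverts G - {y}"
proof -
  let ?T = "insert u (nbrs u)"
  have T: "nbrs y = ?T - {y}" if y: "y \<in> ?T" for y
  proof -
    consider "y = u" | "y = w" | "y \<in> nbrs u" "y \<noteq> w" using y by auto
    then show ?thesis
    proof cases
      case 1
      then show ?thesis by auto
    next
      case 2
      then show ?thesis using tight_edge[OF u w common] by simp
    next
      case 3
      then have "y \<in> nbrs w" using tight_edge[OF u w common] by auto
      then have "nbrs u \<inter> nbrs y \<noteq> {}" using w nbrs_sym by blast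
      then show ?thesis using tight_edge[OF u 3(1)] by simp
    qed
  qed
  have "?T = pverts G"
  proof (rule nbr_closed_eq_verts)
    show "?T \<subseteq> pverts G" using u nbrs_subset by blast
    show "nbrs y \<subseteq> ?T" if "y \<in> ?T" for y using T[OF that] by blast
  qed simp
  then show ?thesis using T by metis
qed

text \<open>
  Look at the last round: the remaining set \<open>R\<close> has \<open>D - 1 \<ge> 2\<close> vertices, and since any vertex of \<open>W\<close> with
  a neighbour in \<open>R\<close> could have been chosen to finish, it is adjacent to all of \<open>R\<close>. So \<open>G\<close>
  contains distinct vertices \<open>x\<close>, \<open>y\<close> with the same neighbours. Now restart with an edge \<open>a x\<close>: every
  neighbour \<open>z\<close> of \<open>x\<close> has the two old neighbours \<open>x\<close> and \<open>y\<close>, hence no new ones, and by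
  triangle-freeness the same neighbours as \<open>a\<close>. This closes up to a complete bipartite graph.
\<close>
lemma tight_triangle_free_imp_bipartite:
  assumes D3: "3 \<le> D"
    and triangle_free: "\<And>u w. u \<in> pverts G \<Longrightarrow> w \<in> nbrs u \<Longrightarrow> nbrs u \<inter> nbrs w = {}"
  shows "\<exists>X Y. pverts G = X \<union> Y \<and> X \<inter> Y = {} \<and> card X = D \<and> card Y = D \<and>
    (\<forall>x\<in>X. nbrs x = Y) \<and> (\<forall>y\<in>Y. nbrs y = X)"
proof -
  note in_verts = subsetD[OF nbrs_subset]
  obtain s where s: "s \<in> pverts G" using degree_attained by auto
  \<comment> \<open>A largest proper grown set \<open>W\<close> is one round away from the whole graph.\<close>
  define P where "P W \<longleftrightarrow> (\<exists>k. grown W k) \<and> W \<noteq> pverts G" for W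
  have "insert s (nbrs s) \<noteq> pverts G"
  proof
    assume eq: "insert s (nbrs s) = pverts G"
    obtain t where t: "t \<in> nbrs s" using nbrs_nonempty[OF s] by auto
    have "nbrs t \<subseteq> insert s (nbrs s)" unfolding eq by (rule nbrs_subset)
    then have "nbrs t \<subseteq> {s}" using triangle_free[OF s t] by blast
    then have "card (nbrs t) \<le> 1" using card_mono[of "{s}" "nbrs t"] by simp
    then show False using tight_regular[OF in_verts[OF t]] D3 by simp
  qed
  then have "P (insert s (nbrs s))" using grown.start[OF s] by (auto simp: P_def)
  moreover have "\<forall>W. P W \<longrightarrow> card W < Suc (card (pverts G))"
    using card_mono[OF pair_finite_verts grown_subset] by (auto simp: P_def less_Suc_eq_le)
  ultimately obtain W where "P W" and max: "\<And>W'. P W' \<Longrightarrow> card W' \<le> card W"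
    using ex_has_greatest_nat[of P _ card] by blast
  then obtain k where W: "grown W k" and proper: "W \<noteq> pverts G" by (auto simp: P_def)
  define R where "R = pverts G - W"
  have last: "R \<subseteq> nbrs u" "nbrs u \<inter> R = nbrs u - W" if u: "u \<in> W" "\<not> nbrs u \<subseteq> W" for u
  proof -
    have "card W < card (W \<union> nbrs u)"
      using u finite_grown[OF W] by (intro psubset_card_mono) auto
    then have "\<not> P (W \<union> nbrs u)" using max not_le by blast
    then have "W \<union> nbrs u = pverts G" using grown.step[OF W u] by (auto simp: P_def)
    then show "R \<subseteq> nbrs u" "nbrs u \<inter> R = nbrs u - W" by (auto simp: R_def)
  qed
  obtain a where a: "a \<in> W" "\<not> nbrs a \<subseteq> W" using grown_proper_extends[OF W proper] .
  have aV: "a \<in> pverts G" using a grown_subset[OF W] by auto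
  have "card (nbrs a - W) = card (nbrs a) - card (nbrs a \<inter> W)"
    by (simp add: card_Diff_subset_Int)
  then have "card (nbrs a - W) = D - 1"
    using tight_one_old_nbr[OF W a] tight_regular[OF aV] by simp
  moreover have "R = nbrs a - W" using last[OF a] by blast
  ultimately have "card R = D - 1" by simp
  then obtain x y where xy: "x \<in> R" "y \<in> R" "x \<noteq> y"
  proof -
    have "\<not> card R \<le> Suc 0" using D3 \<open>card R = D - 1\<close> by simp
    moreover have "finite R" using pair_finite_verts by (simp add: R_def)
    ultimately show ?thesis using card_le_Suc0_iff_eq that by blast
  qed
  have xV: "x \<in> pverts G" using xy by (auto simp: R_def)
  have ax: "a \<in> nbrs x" using last(1)[OF a] xy nbrs_sym by blast
  \<comment> \<open>The set \<open>R\<close> lies in the neighbourhood of \<open>a\<close>, so it is independent and \<open>z\<close> is in \<open>W\<close>.\<close>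
  have R_adj: "R \<subseteq> nbrs z" if z: "z \<in> nbrs x" for z
  proof -
    have zV: "z \<in> pverts G" using z in_verts by blast
    have "z \<notin> R"
      using last(1)[OF a] triangle_free[OF aV] z xy by blast
    then have "z \<in> W" using zV by (auto simp: R_def)
    moreover have "x \<in> nbrs z - W" using z xy nbrs_sym by (auto simp: R_def)
    ultimately show ?thesis using last(1)[of z] by blast
  qed
  let ?N = "insert a (nbrs a)"
  have xa: "x \<in> nbrs a" using ax nbrs_sym by blast
  have disj: "nbrs a \<inter> nbrs x = {}" by (rule triangle_free[OF aV xa])
  have "\<not> nbrs x \<subseteq> ?N"
  proof
    assume "nbrs x \<subseteq> ?N"
    then have "nbrs x \<subseteq> {a}" using disj by auto
    then have "card (nbrs x) \<le> 1" using card_mono[of "{a}" "nbrs x"] by simp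
    then show False using tight_regular[OF xV] D3 by simp
  qed
  then have "grown (?N \<union> nbrs x) (Suc 1)"
    using grown.step[OF grown.start[OF aV]] xa by blast
  moreover have "?N \<union> nbrs x = nbrs a \<union> nbrs x" using ax by auto
  ultimately have two: "grown (nbrs a \<union> nbrs x) (Suc 1)" by simp
  have left: "nbrs z = nbrs a" if z: "z \<in> nbrs x" for z
  proof -
    have zV: "z \<in> pverts G" using z in_verts by blast
    have "nbrs z \<subseteq> nbrs a \<union> nbrs x"
    proof (rule ccontr)
      assume "\<not> nbrs z \<subseteq> nbrs a \<union> nbrs x"
      then have "card (nbrs z \<inter> (nbrs a \<union> nbrs x)) = 1"
        using tight_one_old_nbr[OF two] z by blast
      moreover have "x \<in> nbrs z \<inter> (nbrs a \<union> nbrs x)" "y \<in> nbrs z \<inter> (nbrs a \<union> nbrs x)"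
        using R_adj[OF z] R_adj[OF ax] xy by auto
      ultimately show False using xy(3) by (metis card_1_singletonE singletonD)
    qed
    then have "nbrs z \<subseteq> nbrs a" using triangle_free[OF xV z] by blast
    then show ?thesis
      using tight_regular[OF zV] tight_regular[OF aV] by (simp add: card_subset_eq)
  qed
  have right: "nbrs b = nbrs x" if b: "b \<in> nbrs a" for b
  proof -
    have "nbrs x \<subseteq> nbrs b" using left b nbrs_sym by blast
    moreover have "card (nbrs b) = card (nbrs x)"
      using b tight_regular in_verts xV by simp
    ultimately show ?thesis by (metis card_subset_eq finite_nbrs)
  qed
  have "nbrs a \<union> nbrs x = pverts G"
  proof (rule nbr_closed_eq_verts)
    show "nbrs a \<union> nbrs x \<subseteq> pverts G" using nbrs_subset by auto
    show "nbrs a \<union> nbrs x \<noteq> {}" using ax by auto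
    show "nbrs z \<subseteq> nbrs a \<union> nbrs x" if "z \<in> nbrs a \<union> nbrs x" for z
      using that left[of z] right[of z] by blast
  qed
  then have V: "pverts G = nbrs a \<union> nbrs x" ..
  show ?thesis
  proof (intro exI conjI ballI)
    show "pverts G = nbrs a \<union> nbrs x" by (rule V)
    show "nbrs a \<inter> nbrs x = {}" by (rule disj)
    show "card (nbrs a) = D" "card (nbrs x) = D" by (rule tight_regular[OF aV] tight_regular[OF xV])+
    show "nbrs b = nbrs x" if "b \<in> nbrs a" for b by (rule right[OF that])
    show "nbrs z = nbrs a" if "z \<in> nbrs x" for z by (rule left[OF that])
  qed
qed

end

end

section \<open>The bound, complete graphs and complete bipartite graphs\<close>

locale gain_graph_spectrum =
  enumerated_gain_graph G \<phi> n v + max_degree_graph G D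
  for G :: "'a pair_pre_digraph" and \<phi> n v D +
  fixes \<alpha> :: real
  assumes \<alpha>_less_1: "\<alpha> < 1"
begin

abbreviation mult :: "complex \<Rightarrow> nat" where
  "mult lam \<equiv> eigenvalue_mult (A_alpha \<alpha> G \<phi> n v) lam"

lemma eigenfunction_forced_zero:
  assumes x: "eigenfunction \<alpha> lam x" and u: "u \<in> pverts G" "x u = 0" and w: "w \<in> nbrs u"
    and others: "\<And>y. y \<in> nbrs u \<Longrightarrow> y \<noteq> w \<Longrightarrow> x y = 0"
  shows "x w = 0"
proof -
  have "of_real (1 - \<alpha>) * (\<Sum>y\<in>nbrs u. \<phi> (u, y) * x y) = 0"
    using x u unfolding eigenfunction_def by force
  moreover have "(\<Sum>y\<in>nbrs u. \<phi> (u, y) * x y) = \<phi> (u, w) * x w"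
    using w others by (subst sum.remove[of _ w]) (auto intro!: sum.neutral)
  ultimately show ?thesis
    using \<alpha>_less_1 gain_nonzero[OF w] by (simp del: of_real_diff)
qed

text \<open>
  In each round one of the new vertices is left out of \<open>Z\<close>: the eigenvalue equation at the vertex
  whose neighbours are added determines the value there.
\<close>
lemma grown_zero_forcing:
  assumes "grown W k"
  shows "\<exists>Z \<subseteq> W. card Z + k = card W \<and>
    (\<forall>x. eigenfunction \<alpha> lam x \<longrightarrow> (\<forall>z\<in>Z. x z = 0) \<longrightarrow> (\<forall>w\<in>W. x w = 0))"
  using assms
proof (induction rule: grown.induct)
  case (start u)
  obtain w where w: "w \<in> nbrs u" using nbrs_nonempty[OF start] by blast
  have uw: "u \<noteq> w" using w not_own_nbr by metis
  let ?W = "insert u (nbrs u)"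
  let ?Z = "?W - {w}"
  have "x w = 0" if "eigenfunction \<alpha> lam x" "\<forall>z\<in>?Z. x z = 0" for x
  proof (rule eigenfunction_forced_zero[OF that(1) start _ w])
    show "x u = 0" using that(2) uw by blast
    show "x y = 0" if "y \<in> nbrs u" "y \<noteq> w" for y using \<open>\<forall>z\<in>?Z. x z = 0\<close> that by blast
  qed
  moreover have "card ?Z + 1 = card ?W"
    using w card_Suc_Diff1[of ?W w] by simp
  ultimately show ?case by (intro exI[of _ ?Z]) blast
next
  case (step W k u)
  then obtain Z where Z: "Z \<subseteq> W" "card Z + k = card W"
    and forces: "\<And>x. eigenfunction \<alpha> lam x \<Longrightarrow> \<forall>z\<in>Z. x z = 0 \<Longrightarrow> \<forall>w\<in>W. x w = 0" by blast
  obtain w where w: "w \<in> nbrs u" "w \<notin> W" using step.hyps by blast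
  have u: "u \<in> pverts G" using step.hyps grown_subset by blast
  have finW: "finite W" using finite_grown[OF step.hyps(1)] .
  let ?R = "nbrs u - W"
  let ?Z = "Z \<union> (?R - {w})"
  have "card ?Z = card Z + card (?R - {w})"
    using Z finW finite_subset by (intro card_Un_disjoint) auto
  moreover have "card ?R = Suc (card (?R - {w}))"
    using w by (intro card.remove) auto
  moreover have "card (W \<union> nbrs u) = card W + card ?R"
    using finW card_Un_disjoint[of W ?R] by simp
  ultimately have "card ?Z + Suc k = card (W \<union> nbrs u)" using Z(2) by simp
  moreover have "\<forall>y \<in> W \<union> nbrs u. x y = 0"
    if x: "eigenfunction \<alpha> lam x" and zero: "\<forall>z\<in>?Z. x z = 0" for x
  proof -
    have W0: "\<forall>y\<in>W. x y = 0" using forces[OF x] zero by blast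
    have "x w = 0"
    proof (rule eigenfunction_forced_zero[OF x u _ w(1)])
      show "x u = 0" using W0 step.hyps(2) by blast
      show "x y = 0" if "y \<in> nbrs u" "y \<noteq> w" for y using W0 zero that by blast
    qed
    then show ?thesis using W0 zero by blast
  qed
  moreover have "?Z \<subseteq> W \<union> nbrs u" using Z by blast
  ultimately show ?case by blast
qed

lemma mult_plus_grown_le:
  assumes "grown (pverts G) k"
  shows "mult lam + k \<le> n"
proof -
  obtain Z where Z: "Z \<subseteq> pverts G" "card Z + k = card (pverts G)"
    and forces: "\<And>x. eigenfunction \<alpha> lam x \<Longrightarrow> \<forall>z\<in>Z. x z = 0 \<Longrightarrow> \<forall>w\<in>pverts G. x w = 0"
    using grown_zero_forcing[OF assms] by blast
  have "mult lam \<le> card Z"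
  proof (rule ccontr)
    assume "\<not> mult lam \<le> card Z"
    then show False
      using eigenfunction_vanishing_on[OF Z(1), of \<alpha> lam] forces by (metis not_le)
  qed
  then show ?thesis using Z(2) card_verts by simp
qed

text \<open>
  The bound of the theorem without division and without subtracting \<open>mult lam\<close>.
\<close>
lemma mult_bound: "(D - 1) * mult lam + n \<le> (D - 1) * n + 2"
proof -
  obtain s where s: "s \<in> pverts G" using degree_attained by blast
  obtain k where k: "grown (pverts G) k"
    using grown_exhausts[OF grown.start[OF s]] by blast
  have "(D - 1) * mult lam + k * (D - 1) \<le> (D - 1) * n"
    using mult_le_mono2[OF mult_plus_grown_le[OF k, of lam], of "D - 1"]
    by (simp add: algebra_simps)
  then show ?thesis using card_grown_le[OF k] by (simp add: card_verts)
qed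

lemma mult_extremal_imp_tight:
  assumes "(D - 1) * mult lam + n = (D - 1) * n + 2"
  shows tight
proof (rule tightI)
  fix k assume k: "grown (pverts G) k"
  have "(D - 1) * mult lam + k * (D - 1) \<le> (D - 1) * n"
    using mult_le_mono2[OF mult_plus_grown_le[OF k, of lam], of "D - 1"]
    by (simp add: algebra_simps)
  then show "card (pverts G) = 2 + k * (D - 1)"
    using card_grown_le[OF k] assms by (simp add: card_verts)
qed

text \<open>
  On a complete graph \<open>A\<^sub>\<alpha> = \<alpha>(n - 1) + (1 - \<alpha>)A\<close>.
\<close>
lemma eigenfunction_complete_iff:
  assumes complete: "\<And>u. u \<in> pverts G \<Longrightarrow> nbrs u = pverts G - {u}"
  shows "eigenfunction \<alpha> (of_real (\<alpha> * (real n - 1)) + of_real (1 - \<alpha>) * \<kappa>) x \<longleftrightarrow> eigenfunction 0 \<kappa> x"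
proof -
  have "of_real \<alpha> * of_nat (card (nbrs u)) * x u + of_real (1 - \<alpha>) * S
      = (of_real (\<alpha> * (real n - 1)) + of_real (1 - \<alpha>) * \<kappa>) * x u \<longleftrightarrow> S = \<kappa> * x u"
    if "u \<in> pverts G" for u S
  proof -
    have "Suc (card (nbrs u)) = n"
      using that complete[OF that] pair_finite_verts card_verts by (metis card_Suc_Diff1)
    then have "of_nat (card (nbrs u)) = complex_of_real (real n - 1)" by auto
    moreover have "complex_of_real (1 - \<alpha>) \<noteq> 0" using \<alpha>_less_1 by (simp del: of_real_diff)
    ultimately show ?thesis
      unfolding of_real_mult distrib_right mult.assoc by (simp del: of_real_diff)
  qed
  then show ?thesis unfolding eigenfunction_def by (simp del: of_real_diff)
qed

lemma A_alpha_0: "A_alpha 0 G \<phi> n v = gain_adj_mat G \<phi> n v"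
  by (rule eq_matI) (auto simp: A_alpha_def degree_mat_def gain_adj_mat_def)

lemma mult_complete:
  assumes "\<And>u. u \<in> pverts G \<Longrightarrow> nbrs u = pverts G - {u}"
  shows "mult (of_real (\<alpha> * (real n - 1)) + of_real (1 - \<alpha>) * \<kappa>)
    = eigenvalue_mult (gain_adj_mat G \<phi> n v) \<kappa>"
  using eigenvalue_mult_cong eigenfunction_complete_iff[OF assms] by (simp add: A_alpha_0)

end

locale bipartite_gain_graph_spectrum = gain_graph_spectrum +
  fixes X Y :: "'a set"
  assumes parts: "pverts G = X \<union> Y" "X \<inter> Y = {}" "card X = D" "card Y = D"
    and nbrs_X: "\<And>x. x \<in> X \<Longrightarrow> nbrs x = Y"
    and nbrs_Y: "\<And>y. y \<in> Y \<Longrightarrow> nbrs y = X"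
begin

lemma finite_parts: "finite X" "finite Y"
  using parts(1) pair_finite_verts by (metis finite_Un)+

lemma n_eq: "n = 2 * D"
  using card_Un_disjoint[OF finite_parts parts(2)] parts card_verts by simp

text \<open>
  The complement of \<open>S\<close> is too small to force eigenfunctions to vanish.
\<close>
lemma eigenfunction_supported_on:
  assumes S: "S \<subseteq> pverts G" and card: "n < mult lam + card S"
  obtains f where "eigenfunction \<alpha> lam f" "\<And>u. u \<in> pverts G \<Longrightarrow> u \<notin> S \<Longrightarrow> f u = 0"
    "\<exists>u \<in> S. f u \<noteq> 0"
proof -
  have "card (pverts G - S) = n - card S"
    using S pair_finite_verts card_verts finite_subset by (metis card_Diff_subset)
  moreover have "card S \<le> n" using S pair_finite_verts card_verts by (metis card_mono)
  ultimately have "card (pverts G - S) < mult lam" using card by simp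
  then obtain f where "eigenfunction \<alpha> lam f" "\<And>u. u \<in> pverts G - S \<Longrightarrow> f u = 0"
    "\<exists>u \<in> pverts G. f u \<noteq> 0"
    using eigenfunction_vanishing_on[of "pverts G - S" \<alpha> lam] by blast
  then show ?thesis using that by blast
qed

lemma row_X:
  assumes "eigenfunction \<alpha> lam f" "x \<in> X"
  shows "of_real \<alpha> * of_nat D * f x + of_real (1 - \<alpha>) * (\<Sum>y\<in>Y. \<phi> (x, y) * f y) = lam * f x"
  using assms nbrs_X parts unfolding eigenfunction_def by force

lemma row_Y:
  assumes "eigenfunction \<alpha> lam f" "y \<in> Y"
  shows "of_real \<alpha> * of_nat D * f y + of_real (1 - \<alpha>) * (\<Sum>x\<in>X. \<phi> (y, x) * f x) = lam * f y"
  using assms nbrs_Y parts unfolding eigenfunction_def by force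

text \<open>
  Take a nonzero eigenfunction supported on three vertices of one side. In the equation at one of
  these vertices the neighbours contribute nothing.
\<close>
lemma extremal_eigenvalue:
  assumes D3: "3 \<le> D" and m: "mult lam + 2 = n"
  shows "lam = of_real \<alpha> * of_nat D"
proof -
  obtain S where S: "S \<subseteq> X" "card S = 3"
    using D3 parts(3) by (metis obtain_subset_with_card_n)
  have "S \<subseteq> pverts G" "n < mult lam + card S" using S m parts(1) by auto
  then obtain f where f: "eigenfunction \<alpha> lam f" "\<And>u. u \<in> pverts G \<Longrightarrow> u \<notin> S \<Longrightarrow> f u = 0"
    "\<exists>u \<in> S. f u \<noteq> 0"
    by (rule eigenfunction_supported_on) (rule that)
  then obtain u where u: "u \<in> S" "f u \<noteq> 0" by blast
  have "f y = 0" if "y \<in> Y" for y using that f(2) S parts by blast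
  then have "of_real \<alpha> * of_nat D * f u = lam * f u"
    using row_X[OF f(1), of u] u S by (simp add: subset_iff)
  then show ?thesis using u(2) by simp
qed

text \<open>
  Take a nonzero eigenfunction supported on \<open>x\<close>, \<open>x'\<close> and a vertex \<open>z\<close> of the other side. The equation at
  \<open>x\<close> gives \<open>f z = 0\<close>, and the equations at the vertices of \<open>Y\<close> then relate the two columns.
\<close>
lemma extremal_columns_proportional:
  assumes lam: "lam = of_real \<alpha> * of_nat D" and m: "mult lam + 2 = n"
    and x: "x \<in> X" "x' \<in> X"
  shows "\<exists>c. \<forall>y\<in>Y. \<phi> (y, x) = c * \<phi> (y, x')"
proof (cases "x = x'")
  case True
  then show ?thesis by (metis mult_1)
next
  case False
  obtain z where z: "z \<in> Y" using parts(4) D_ge_2 by fastforce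
  have alpha: "complex_of_real (1 - \<alpha>) \<noteq> 0" using \<alpha>_less_1 by (simp del: of_real_diff)
  have zX: "z \<noteq> x" "z \<noteq> x'" using z x parts(2) by blast+
  let ?S = "{x, x', z}"
  have "?S \<subseteq> pverts G" "card ?S = 3" using x z False zX parts(1) by auto
  then obtain f where f: "eigenfunction \<alpha> lam f" "\<And>u. u \<in> pverts G \<Longrightarrow> u \<notin> ?S \<Longrightarrow> f u = 0"
    and nz: "\<exists>u \<in> ?S. f u \<noteq> 0"
    using eigenfunction_supported_on[of ?S lam] m by auto
  have sums: "(\<Sum>y\<in>Y. \<phi> (x, y) * f y) = 0" "\<And>y. y \<in> Y \<Longrightarrow> (\<Sum>w\<in>X. \<phi> (y, w) * f w) = 0"
    using row_X[OF f(1) x(1)] row_Y[OF f(1)] alpha by (auto simp: lam simp del: of_real_diff)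
  have "(\<Sum>y\<in>Y. \<phi> (x, y) * f y) = (\<Sum>y\<in>Y. if y = z then \<phi> (x, z) * f z else 0)"
    using f(2) x parts by (intro sum.cong) auto
  then have "\<phi> (x, z) * f z = 0" using sums(1) z finite_parts by simp
  then have fz: "f z = 0" using gain_nonzero[of z x] nbrs_X[OF x(1)] z by simp
  have two: "\<phi> (y, x) * f x + \<phi> (y, x') * f x' = 0" if y: "y \<in> Y" for y
  proof -
    have "(\<Sum>w\<in>X. \<phi> (y, w) * f w) = (\<Sum>w\<in>{x, x'}. \<phi> (y, w) * f w)"
      using f(2) x z parts finite_parts by (intro sum.mono_neutral_right) auto
    then show ?thesis using sums(2)[OF y] False by simp
  qed
  have unit: "\<phi> (z, x') \<noteq> 0" using gain_nonzero[of x' z] nbrs_Y[OF z] x by simp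
  have "f x \<noteq> 0"
  proof
    assume "f x = 0"
    then have "f x' = 0" using two[OF z] unit by simp
    then show False using nz fz \<open>f x = 0\<close> by blast
  qed
  then have "\<phi> (y, x) = - (f x' / f x) * \<phi> (y, x')" if "y \<in> Y" for y
    using two[OF that] by (simp add: field_simps eq_neg_iff_add_eq_0)
  then show ?thesis by blast
qed

lemma extremal_switching_trivial:
  assumes lam: "lam = of_real \<alpha> * of_nat D" and m: "mult lam + 2 = n"
  shows "switching_equivalent G \<phi> (\<lambda>_. 1)"
proof -
  obtain x0 where x0: "x0 \<in> X" using parts(3) D_ge_2 by fastforce
  obtain y0 where y0: "y0 \<in> Y" using parts(4) D_ge_2 by fastforce
  obtain c where c: "\<And>x y. x \<in> X \<Longrightarrow> y \<in> Y \<Longrightarrow> \<phi> (y, x) = c x * \<phi> (y, x0)"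
    using extremal_columns_proportional[OF lam m _ x0] by metis
  \<comment> \<open>Switching so that all gains at \<open>x0\<close> become 1 makes proportional columns constant.\<close>
  define \<zeta> where "\<zeta> u = (if u \<in> X then c u else \<phi> (x0, u))" for u
  have arcs: "(x, y) \<in> parcs G" "(y, x) \<in> parcs G" if "x \<in> X" "y \<in> Y" for x y
    using that nbrs_X nbrs_Y by (auto simp: nbrs_def)
  have unit: "cmod (\<phi> (y, x)) = 1" "cmod (\<phi> (x, y)) = 1" if "x \<in> X" "y \<in> Y" for x y
    using gain_unit arcs that by blast+
  have notX: "y \<notin> X" if "y \<in> Y" for y using that parts(2) by blast
  have "cmod (c x) = 1" if "x \<in> X" for x
    using arg_cong[OF c[OF that y0], of cmod] unit[OF that y0] unit[OF x0 y0] by (simp add: norm_mult)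
  then have "\<forall>u \<in> pverts G. cmod (\<zeta> u) = 1"
    using unit x0 parts(1) by (auto simp: \<zeta>_def)
  moreover have yx: "\<phi> (y, x) = inverse (\<zeta> y) * 1 * \<zeta> x" if "x \<in> X" "y \<in> Y" for x y
    using c[OF that] gain_inverse[OF arcs(2)[OF x0 that(2)]] that notX by (simp add: \<zeta>_def)
  moreover have "\<phi> (x, y) = inverse (\<zeta> x) * 1 * \<zeta> y" if "x \<in> X" "y \<in> Y" for x y
    using yx[OF that] gain_inverse[OF arcs(1)[OF that]] by simp
  moreover have "(i, j) \<in> parcs G \<Longrightarrow> i \<in> X \<and> j \<in> Y \<or> i \<in> Y \<and> j \<in> X" for i j
    using nbrs_X[of i] nbrs_Y[of i] parts(1) in_arcsD1[of i j] by (auto simp: nbrs_def)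
  ultimately show ?thesis unfolding switching_equivalent_def by (intro exI[of _ \<zeta>]) blast
qed

text \<open>
  After switching to gains 1, this is the difference of two point masses on the same side, which
  is annihilated by the adjacency matrix.
\<close>
lemma dipole_eigenfunction:
  assumes sides: "A = X \<and> B = Y \<or> A = Y \<and> B = X"
    and \<zeta>: "\<And>u. u \<in> pverts G \<Longrightarrow> \<zeta> u \<noteq> 0"
    and \<phi>: "\<And>i j. (i, j) \<in> parcs G \<Longrightarrow> \<phi> (i, j) = inverse (\<zeta> i) * \<zeta> j"
    and a: "a \<in> A" "b \<in> A" "a \<noteq> b"
  shows "eigenfunction \<alpha> (of_real \<alpha> * of_nat D)
    (\<lambda>u. if u = a then 1 else if u = b then - \<zeta> a / \<zeta> b else 0)"
    (is "eigenfunction _ _ ?f")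
  unfolding eigenfunction_def
proof
  fix u assume u: "u \<in> pverts G"
  have A: "finite A" "A \<subseteq> pverts G" using sides finite_parts parts(1) by auto
  have nbrs_card: "card (nbrs u) = D" using u nbrs_X nbrs_Y parts by auto
  have "(\<Sum>w\<in>nbrs u. \<phi> (u, w) * ?f w) = 0"
  proof (cases "u \<in> A")
    case True
    then have "nbrs u = B" using sides nbrs_X nbrs_Y by blast
    then show ?thesis using a sides parts(2) by (intro sum.neutral) auto
  next
    case False
    then have nb: "nbrs u = A" using sides nbrs_X nbrs_Y u parts(1) by blast
    have "(\<Sum>w\<in>A. \<phi> (u, w) * ?f w) = (\<Sum>w\<in>{a, b}. \<phi> (u, w) * ?f w)"
      using a A by (intro sum.mono_neutral_right) auto
    also have "\<dots> = \<phi> (u, a) - \<phi> (u, b) * \<zeta> a / \<zeta> b" using a by simp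
    also have "\<dots> = 0"
      using \<phi>[of u a] \<phi>[of u b] \<zeta>[of b] a A nb by (auto simp: nbrs_def)
    finally show ?thesis using nb by simp
  qed
  then show "of_real \<alpha> * of_nat (card (nbrs u)) * ?f u
      + of_real (1 - \<alpha>) * (\<Sum>w\<in>nbrs u. \<phi> (u, w) * ?f w) = of_real \<alpha> * of_nat D * ?f u"
    by (simp add: nbrs_card)
qed

lemma switching_trivial_mult_ge:
  assumes "switching_equivalent G \<phi> (\<lambda>_. 1)"
  shows "n \<le> mult (of_real \<alpha> * of_nat D) + 2"
proof -
  obtain \<zeta> where \<zeta>: "\<And>u. u \<in> pverts G \<Longrightarrow> cmod (\<zeta> u) = 1"
    and arcs: "\<forall>(i, j) \<in> parcs G. \<phi> (i, j) = inverse (\<zeta> i) * 1 * \<zeta> j"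
    using assms unfolding switching_equivalent_def by blast
  have \<phi>: "\<phi> (i, j) = inverse (\<zeta> i) * \<zeta> j" if "(i, j) \<in> parcs G" for i j
    using bspec[OF arcs that] by simp
  have nz: "\<zeta> u \<noteq> 0" if "u \<in> pverts G" for u using \<zeta>[OF that] by auto
  obtain x0 where x0: "x0 \<in> X" using parts(3) D_ge_2 by fastforce
  obtain y0 where y0: "y0 \<in> Y" using parts(4) D_ge_2 by fastforce
  have ne: "x0 \<noteq> y0" using x0 y0 parts(2) by blast
  let ?Z = "pverts G - {x0, y0}"
  have "card ?Z \<le> mult (of_real \<alpha> * of_nat D)"
  proof (rule card_le_eigenvalue_mult)
    fix z assume z: "z \<in> ?Z"
    define A B b where "A = (if z \<in> X then X else Y)" and "B = (if z \<in> X then Y else X)"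
      and "b = (if z \<in> X then x0 else y0)"
    have AB: "A = X \<and> B = Y \<or> A = Y \<and> B = X" "z \<in> A" "b \<in> A" "z \<noteq> b" "b \<in> {x0, y0}"
      using z x0 y0 parts(1) by (auto simp: A_def B_def b_def)
    show "\<exists>f. eigenfunction \<alpha> (of_real \<alpha> * of_nat D) f \<and> f z = 1 \<and> (\<forall>z' \<in> ?Z - {z}. f z' = 0)"
      using dipole_eigenfunction[OF AB(1) nz \<phi> AB(2-4)] AB(5)
      by (intro exI[of _ "\<lambda>u. if u = z then 1 else if u = b then - \<zeta> z / \<zeta> b else 0"]) auto
  qed auto
  moreover have "card ?Z + 2 = n"
    using x0 y0 ne parts(1) pair_finite_verts card_verts n_eq D_ge_2
      card_Diff_subset[of "{x0, y0}" "pverts G"] by simp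
  ultimately show ?thesis by simp
qed

end

section \<open>Connected 2-regular graphs are cycles\<close>

lemma mod_Suc_eq_iff:
  assumes "3 \<le> n" "i < n" "j < n"
  shows "Suc j mod n = i \<longleftrightarrow> j = (i + n - 1) mod n"
proof (cases "i = 0")
  case True
  then show ?thesis using assms by (auto simp: mod_Suc)
next
  case False
  then have "(i + n - 1) mod n = i - 1" using assms by (simp add: mod_if)
  then show ?thesis using assms False by (auto simp: mod_Suc)
qed

lemma (in pair_graph) cycle_traversal_nbrs:
  assumes c: "cycle_traversal n G c" and i: "i < n"
  shows "nbrs (c i) = {c (Suc i mod n), c ((i + n - 1) mod n)}"
    "c (Suc i mod n) \<noteq> c ((i + n - 1) mod n)"
proof -
  have n: "3 \<le> n" and bij: "bij_betw c {..<n} (pverts G)"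
    and arcs: "parcs G = (\<Union>i<n. {(c i, c (Suc i mod n)), (c (Suc i mod n), c i)})"
    using c by (auto simp: cycle_traversal_def)
  have inj: "c a = c b \<longleftrightarrow> a = b" if "a < n" "b < n" for a b
    using bij that by (auto simp: bij_betw_def inj_on_def)
  have lt: "a mod n < n" for a using n by simp
  have "w \<in> nbrs (c i) \<longleftrightarrow> (\<exists>j<n. c i = c j \<and> w = c (Suc j mod n) \<or> c i = c (Suc j mod n) \<and> w = c j)" for w
    unfolding nbrs_def arcs by auto
  also have "\<dots> w \<longleftrightarrow> (\<exists>j<n. i = j \<and> w = c (Suc j mod n) \<or> Suc j mod n = i \<and> w = c j)" for w
    using inj i lt by metis
  also have "\<dots> w \<longleftrightarrow> w \<in> {c (Suc i mod n), c ((i + n - 1) mod n)}" for w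
    using mod_Suc_eq_iff[OF n i lt[of "i + n - 1"]] mod_Suc_eq_iff[OF n i] i lt[of "i + n - 1"]
    unfolding insert_iff empty_iff by metis
  finally show "nbrs (c i) = {c (Suc i mod n), c ((i + n - 1) mod n)}" by blast
  have "Suc i mod n \<noteq> (i + n - 1) mod n"
  proof (cases "i = 0")
    case True
    then show ?thesis using n by simp
  next
    case False
    then have "(i + n - 1) mod n = i - 1" using i by (simp add: mod_if)
    then show ?thesis using i n False by (auto simp: mod_Suc)
  qed
  then show "c (Suc i mod n) \<noteq> c ((i + n - 1) mod n)"
    using inj[OF lt lt] by blast
qed

context max_degree_graph
begin

text \<open>
  Never turning back determines an infinite walk in a 2-regular graph.
\<close>
lemma two_regular_walk:
  assumes regular: "\<And>u. u \<in> pverts G \<Longrightarrow> card (nbrs u) = 2"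
  obtains w :: "nat \<Rightarrow> 'a" where "\<And>i. w i \<in> pverts G" "\<And>i. nbrs (w (Suc i)) = {w i, w (Suc (Suc i))}"
    "\<And>i. w (Suc (Suc i)) \<noteq> w i" "w 1 \<in> nbrs (w 0)"
proof -
  define other where "other u p = (SOME q. q \<in> nbrs u \<and> q \<noteq> p)" for u p
  have other: "nbrs u = {p, other u p}" "other u p \<noteq> p"
    if u: "u \<in> pverts G" and p: "p \<in> nbrs u" for u p
  proof -
    obtain a b where ab: "nbrs u = {a, b}" "a \<noteq> b"
      using regular[OF u] unfolding card_2_iff by blast
    then have "\<exists>q. q \<in> nbrs u \<and> q \<noteq> p" by auto
    then have "other u p \<in> nbrs u \<and> other u p \<noteq> p"
      unfolding other_def by (rule someI_ex)
    then show "nbrs u = {p, other u p}" "other u p \<noteq> p" using ab p by auto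
  qed
  obtain s where s: "s \<in> pverts G" using degree_attained by blast
  obtain t where t: "t \<in> nbrs s" using nbrs_nonempty[OF s] by blast
  define e where "e i = ((\<lambda>(p, u). (u, other u p)) ^^ i) (s, t)" for i
  define w where "w i = fst (e i)" for i
  have e_Suc: "e (Suc i) = (snd (e i), other (snd (e i)) (fst (e i)))" for i
    by (simp add: e_def case_prod_beta)
  have w_Suc: "w (Suc i) = snd (e i)" "w (Suc (Suc i)) = other (w (Suc i)) (w i)" for i
    by (simp_all add: w_def e_Suc)
  have arc: "w i \<in> pverts G \<and> w (Suc i) \<in> nbrs (w i)" for i
  proof (induction i)
    case 0
    then show ?case using s t by (simp add: w_def e_Suc) (simp add: e_def)
  next
    case (Suc i)
    then have "w (Suc i) \<in> pverts G" "w i \<in> nbrs (w (Suc i))" using nbrs_subset nbrs_sym by blast+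
    from other(1)[OF this] show ?case using \<open>w (Suc i) \<in> pverts G\<close> by (auto simp: w_Suc(2))
  qed
  have V: "w i \<in> pverts G" and rev_adj: "w i \<in> nbrs (w (Suc i))" for i
    using arc nbrs_sym by blast+
  show ?thesis
    using V arc other[OF V rev_adj] by (intro that[of w]) (simp_all add: w_Suc(2))
qed

text \<open>
  The first repetition on the non-backtracking walk is a return to its origin, as any other vertex
  already has both its neighbours on the walk; the vertices up to then are closed under adjacency.
\<close>
lemma two_regular_imp_cycle:
  assumes regular: "\<And>u. u \<in> pverts G \<Longrightarrow> card (nbrs u) = 2"
  shows "\<exists>c. cycle_traversal (card (pverts G)) G c"
proof -
  obtain w :: "nat \<Rightarrow> 'a" where V: "\<And>i. w i \<in> pverts G"
    and nb: "\<And>i. nbrs (w (Suc i)) = {w i, w (Suc (Suc i))}"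
    and ne: "\<And>i. w (Suc (Suc i)) \<noteq> w i" and first: "w 1 \<in> nbrs (w 0)"
    using two_regular_walk[OF regular] by metis
  have adj: "w (Suc i) \<in> nbrs (w i)" for i
    using nb first by (cases i) auto
  have ne1: "w (Suc i) \<noteq> w i" for i
    using adj[of i] not_own_nbr by metis
  have "\<not> inj w"
    using V pair_finite_verts by (metis finite_subset image_subsetI infinite_UNIV_nat range_inj_infinite)
  then have ex: "\<exists>q i. i < q \<and> w i = w q"
    by (metis injI linorder_neqE_nat)
  define p where "p = (LEAST q. \<exists>i<q. w i = w q)"
  obtain i0 where i0: "i0 < p" "w i0 = w p"
    using LeastI_ex[OF ex] unfolding p_def by blast
  have distinct: "w i \<noteq> w q" if "i < q" "q < p" for i q
    using that not_less_Least[of q "\<lambda>q. \<exists>i<q. w i = w q"] unfolding p_def by blast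
  have inj: "inj_on w {..<p}"
    by (rule inj_onI) (metis distinct lessThan_iff linorder_neqE_nat)
  \<comment> \<open>Otherwise the vertex before the repetition is one of the two neighbours that an inner
    vertex has on the walk, which is an earlier repetition or a step back.\<close>
  have "i0 = 0"
  proof (rule ccontr)
    assume "i0 \<noteq> 0"
    then obtain j where j: "i0 = Suc j" by (cases i0) auto
    obtain q where q: "p = Suc q" using i0 by (cases p) auto
    have "w q \<in> nbrs (w p)" using adj[of q] nbrs_sym q by blast
    then have "w q \<in> {w j, w (Suc (Suc j))}" using nb[of j] i0 j by simp
    moreover have "w q \<noteq> w j" using distinct[of j q] i0 j q by auto
    ultimately have eq: "w q = w (Suc (Suc j))" by blast
    have "q = Suc (Suc j)"
    proof (cases "Suc (Suc j) < p")
      case True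
      then show ?thesis using eq inj q by (auto simp: inj_on_def)
    next
      case False
      then have "q = Suc j" using i0 j q by auto
      then show ?thesis using eq ne1[of "Suc j"] by metis
    qed
    then show False using i0 j q ne[of "Suc j"] by simp
  qed
  then have wp: "w p = w 0" and p0: "0 < p" using i0 by auto
  have p3: "3 \<le> p"
  proof (rule ccontr)
    assume "\<not> 3 \<le> p"
    then have "p = 1 \<or> p = 2" using p0 by linarith
    then show False using wp ne1[of 0] ne[of 0] by (auto simp: numeral_2_eq_2)
  qed
  have wmod: "w (Suc i mod p) = w (Suc i)" if "i < p" for i
    using that wp by (cases "Suc i = p") auto
  have pred: "w (Suc (p - 1)) = w p" using p0 by simp
  have nb0: "nbrs (w 0) = {w 1, w (p - 1)}"
  proof -
    have "w (p - 1) \<in> nbrs (w 0)" using adj[of "p - 1"] nbrs_sym pred wp by metis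
    moreover have "w 1 \<noteq> w (p - 1)" using distinct[of 1 "p - 1"] p3 by auto
    ultimately have "{w 1, w (p - 1)} \<subseteq> nbrs (w 0)" "card {w 1, w (p - 1)} = card (nbrs (w 0))"
      using first regular[OF V[of 0]] by auto
    then show ?thesis using card_subset_eq finite_nbrs by metis
  qed
  have nbrs_w: "nbrs (w i) = {w (Suc i mod p), w (if i = 0 then p - 1 else i - 1)}" if "i < p" for i
  proof (cases i)
    case 0
    then show ?thesis using nb0 p3 by simp
  next
    case (Suc j)
    then show ?thesis using nb[of j] wmod[OF that] by auto
  qed
  have all: "w ` {..<p} = pverts G"
  proof (rule nbr_closed_eq_verts)
    show "w ` {..<p} \<subseteq> pverts G" using V by blast
    show "w ` {..<p} \<noteq> {}" using p0 by auto
    show "nbrs u \<subseteq> w ` {..<p}" if "u \<in> w ` {..<p}" for u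
    proof -
      from that obtain i where i: "i < p" "u = w i" by auto
      then show ?thesis using nbrs_w[OF i(1)] p0 by auto
    qed
  qed
  have "parcs G = (\<Union>i<p. {(w i, w (Suc i mod p)), (w (Suc i mod p), w i)})" (is "_ = ?R")
  proof (rule Set.set_eqI)
    fix a :: "'a \<times> 'a"
    obtain x y where a: "a = (x, y)" by (cases a)
    show "a \<in> parcs G \<longleftrightarrow> a \<in> ?R"
    proof
      assume "a \<in> parcs G"
      then have xy: "y \<in> nbrs x" "x \<in> pverts G" using a in_arcsD1 by (auto simp: nbrs_def)
      obtain i where i: "i < p" "x = w i" using xy(2) all by auto
      consider "y = w (Suc i mod p)" | "i = 0" "y = w (p - 1)" | j where "i = Suc j" "y = w j"
        using xy(1) nbrs_w[OF i(1)] i(2) by (cases i) auto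
      then show "a \<in> ?R"
      proof cases
        case 1
        then show ?thesis using i a by blast
      next
        case 2
        have "x = w (Suc (p - 1) mod p)" using 2 i p0 by simp
        then show ?thesis using a 2 p0 by (intro UN_I[of "p - 1"]) auto
      next
        case 3
        then have "x = w (Suc j mod p)" using i by simp
        then show ?thesis using a 3 i by (intro UN_I[of j]) auto
      qed
    next
      assume "a \<in> ?R"
      then obtain i where i: "i < p" and "a = (w i, w (Suc i mod p)) \<or> a = (w (Suc i mod p), w i)" by blast
      moreover have "w (Suc i mod p) \<in> nbrs (w i)" using adj wmod[OF i] by simp
      ultimately show "a \<in> parcs G" using nbrs_sym by (auto simp: nbrs_def)
    qed
  qed
  moreover have "card (pverts G) = p" using all card_image[OF inj] by simp
  ultimately have "cycle_traversal (card (pverts G)) G w"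
    using p3 inj all by (simp add: cycle_traversal_def bij_betw_def)
  then show ?thesis by blast
qed

end

section \<open>Eigenfunctions of a cycle\<close>

text \<open>
  The roots of the characteristic equation are \<open>z\<close> and its inverse. The second form covers the double
  root \<open>z = \<plusminus>1\<close>, where the first one is void.
\<close>
lemma chebyshev_closed_form:
  fixes s :: "nat \<Rightarrow> complex"
  assumes s: "s 0 = 0" "s 1 = 1" "\<And>i. s (Suc (Suc i)) = (z + inverse z) * s (Suc i) - s i"
    and z: "z \<noteq> 0"
  shows "(z - inverse z) * s k = z ^ k - inverse z ^ k"
    and "z\<^sup>2 = 1 \<Longrightarrow> z * s k = of_nat k * z ^ k"
proof -
  have "(z - inverse z) * s k = z ^ k - inverse z ^ k
      \<and> (z - inverse z) * s (Suc k) = z ^ Suc k - inverse z ^ Suc k"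
  proof (induction k)
    case 0
    then show ?case using s by simp
  next
    case (Suc k)
    have "(z - inverse z) * s (Suc (Suc k))
        = (z + inverse z) * ((z - inverse z) * s (Suc k)) - (z - inverse z) * s k"
      by (simp add: s(3) algebra_simps)
    also have "\<dots> = (z + inverse z) * (z ^ Suc k - inverse z ^ Suc k) - (z ^ k - inverse z ^ k)"
      using Suc by simp
    also have "\<dots> = z ^ Suc (Suc k) - inverse z ^ Suc (Suc k)
        + (z * inverse z - 1) * (z ^ k - inverse z ^ k)"
      by (simp add: algebra_simps)
    finally show ?case using Suc z by simp
  qed
  then show "(z - inverse z) * s k = z ^ k - inverse z ^ k" by blast
next
  assume z2: "z\<^sup>2 = 1"
  then have inv: "inverse z = z" and zz: "z * z = 1"
    using z by (simp_all add: power2_eq_square inverse_unique)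
  have "z * s k = of_nat k * z ^ k \<and> z * s (Suc k) = of_nat (Suc k) * z ^ Suc k"
  proof (induction k)
    case 0
    then show ?case using s by simp
  next
    case (Suc k)
    have "z * s (Suc (Suc k)) = 2 * z * (z * s (Suc k)) - z * s k"
      by (simp add: s(3) inv algebra_simps)
    also have "\<dots> = 2 * z * (of_nat (Suc k) * z ^ Suc k) - of_nat k * (z * z) * z ^ k"
      using Suc zz by simp
    also have "\<dots> = of_nat (Suc (Suc k)) * z ^ Suc (Suc k)"
      by (simp add: algebra_simps)
    finally show ?case using Suc by blast
  qed
  then show "z * s k = of_nat k * z ^ k" by blast
qed

text \<open>
  From \<open>s n = \<gamma> * s 0 = 0\<close> the double root is excluded and \<open>z ^ n\<close> equals its own inverse;
  \<open>s (Suc n) = \<gamma>\<close> identifies it with \<open>\<gamma>\<close>. So \<open>\<gamma> = \<plusminus>1\<close>, and \<open>z\<close> lies on the unit circle, whence \<open>t\<close> is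
  twice the cosine of its argument.
\<close>
lemma quasiperiodic_chebyshev:
  fixes s :: "nat \<Rightarrow> complex"
  assumes s: "s 0 = 0" "s 1 = 1" "\<And>i. s (Suc (Suc i)) = t * s (Suc i) - s i"
    and n: "0 < n" and per: "\<And>i. s (i + n) = \<gamma> * s i"
  obtains \<theta> where "0 < \<theta>" "\<theta> < pi" "t = of_real (2 * cos \<theta>)"
    "\<gamma> = 1 \<and> cos (real n * \<theta>) = 1 \<or> \<gamma> = - 1 \<and> cos (real n * \<theta>) = - 1"
proof -
  \<comment> \<open>A root of \<open>z\<^sup>2 - t z + 1\<close>.\<close>
  define z where "z = (t + csqrt (t\<^sup>2 - 4)) / 2"
  have "2 * z - t = csqrt (t\<^sup>2 - 4)" by (simp add: z_def field_simps)
  then have "(2 * z - t)\<^sup>2 = t\<^sup>2 - 4" by simp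
  then have "4 * (z * z - t * z + 1) = 0" by (simp add: power2_eq_square algebra_simps)
  then have "z * z - t * z + 1 = 0" by (metis mult_eq_0_iff zero_neq_numeral)
  then have quad: "z * (t - z) = 1" by (simp add: algebra_simps)
  then have z0: "z \<noteq> 0" by auto
  have "inverse z = t - z" using quad by (rule inverse_unique)
  then have t: "t = z + inverse z" by simp
  note closed = chebyshev_closed_form[OF s(1,2) s(3)[unfolded t] z0]
  have sn: "s n = 0" "s (Suc n) = \<gamma>" using per[of 0] per[of 1] s(1,2) by simp_all
  have z2: "z\<^sup>2 \<noteq> 1"
    using closed(2)[of n] sn(1) z0 n by auto
  then have diff: "z - inverse z \<noteq> 0"
    using z0 by (metis eq_iff_diff_eq_0 power2_eq_square right_inverse)
  have inv: "inverse z ^ n = z ^ n" using closed(1)[of n] sn(1) by simp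
  have "(z - inverse z) * \<gamma> = z * z ^ n - inverse z * inverse z ^ n"
    using closed(1)[of "Suc n"] sn(2) by simp
  also have "\<dots> = (z - inverse z) * z ^ n" unfolding inv by (simp add: algebra_simps)
  finally have \<gamma>: "\<gamma> = z ^ n" using diff by simp
  have "\<gamma> * \<gamma> = z ^ n * inverse z ^ n" by (simp add: inv \<gamma>)
  also have "\<dots> = 1" using z0 by (simp flip: power_mult_distrib)
  finally have \<gamma>1: "\<gamma> = 1 \<or> \<gamma> = - 1" by (simp add: square_eq_1_iff)
  then have "cmod z ^ n = 1" using \<gamma> by (auto simp flip: norm_power)
  then have unit: "cmod z = 1" using n power_eq_1_iff[of "cmod z" n] by simp
  define \<theta> where "\<theta> = \<bar>Arg z\<bar>"
  have cis: "cis (Arg z) = z" using cis_Arg[OF z0] unit by (simp add: sgn_eq)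
  have bounds: "- pi < Arg z" "Arg z \<le> pi" using Arg_bounded[of z] by auto
  have "z \<noteq> 1" "z \<noteq> - 1" using z2 by auto
  then have "Arg z \<noteq> 0" "Arg z \<noteq> pi" using cis by auto
  then have \<theta>: "0 < \<theta>" "\<theta> < pi" using bounds by (auto simp: \<theta>_def)
  have "inverse z = cis (- Arg z)" by (metis cis cis_inverse)
  then have "t = of_real (2 * cos \<theta>)"
    unfolding t by (subst (1) cis[symmetric]) (simp add: complex_eq_iff \<theta>_def)
  moreover have "cos (real n * \<theta>) = Re \<gamma>"
  proof -
    have "\<gamma> = cis (real n * Arg z)" unfolding \<gamma> by (metis Complex.DeMoivre cis)
    then show ?thesis by (cases "0 \<le> Arg z") (simp_all add: \<theta>_def)
  qed
  ultimately show ?thesis using that[OF \<theta>] \<gamma>1 by auto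
qed

locale cycle_gain_graph_spectrum = gain_graph_spectrum +
  fixes c :: "nat \<Rightarrow> 'a"
  assumes traversal: "cycle_traversal n G c"
begin

definition cyc :: "nat \<Rightarrow> 'a" where
  "cyc i = c (i mod n)"

definition step_gain :: "nat \<Rightarrow> complex" where
  "step_gain i = \<phi> (cyc i, cyc (Suc i))"

definition walk_gain :: "nat \<Rightarrow> complex" where
  "walk_gain i = (\<Prod>k<i. step_gain k)"

text \<open>
  Multiplying by the gains along the walk switches all steps to gain 1, at the price of a factor
  per turn around the cycle.
\<close>
definition lift :: "('a \<Rightarrow> complex) \<Rightarrow> nat \<Rightarrow> complex" where
  "lift x i = walk_gain i * x (cyc i)"

text \<open>
  The \<open>t\<close> for which the eigenvalue equation becomes \<open>y\<^sub>i\<^sub>+\<^sub>2 = t y\<^sub>i\<^sub>+\<^sub>1 - y\<^sub>i\<close>.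
\<close>
definition ratio :: "complex \<Rightarrow> complex" where
  "ratio lam = (lam - 2 * of_real \<alpha>) / of_real (1 - \<alpha>)"

abbreviation total :: complex where
  "total \<equiv> cycle_gain n \<phi> c"

lemma n3: "3 \<le> n"
  using traversal by (simp add: cycle_traversal_def)

lemma bij_c: "bij_betw c {..<n} (pverts G)"
  using traversal by (simp add: cycle_traversal_def)

lemma cyc_mem: "cyc i \<in> pverts G"
  using bij_c n3 by (auto simp: cyc_def bij_betw_def)

lemma cyc_nbrs: "nbrs (cyc (Suc i)) = {cyc (Suc (Suc i)), cyc i}" "cyc (Suc (Suc i)) \<noteq> cyc i"
proof -
  have lt: "Suc i mod n < n" using n3 by simp
  have "Suc (Suc i mod n) mod n = Suc (Suc i) mod n" by (simp add: mod_Suc_eq)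
  moreover have "(Suc i mod n + n - 1) mod n = i mod n"
  proof -
    have "(Suc i mod n + n - 1) mod n = (Suc i mod n + (n - 1)) mod n" using n3 by simp
    also have "\<dots> = (Suc i + (n - 1)) mod n" by (rule mod_add_left_eq)
    also have "Suc i + (n - 1) = i + n" using n3 by simp
    finally show ?thesis by simp
  qed
  ultimately show "nbrs (cyc (Suc i)) = {cyc (Suc (Suc i)), cyc i}" "cyc (Suc (Suc i)) \<noteq> cyc i"
    using cycle_traversal_nbrs[OF traversal lt] by (simp_all add: cyc_def)
qed

lemma verts_cyc: "u \<in> pverts G \<Longrightarrow> \<exists>i. u = cyc (Suc i)"
proof -
  assume "u \<in> pverts G"
  then obtain i where "i < n" "u = c i" using bij_c by (auto simp: bij_betw_def)
  then have "u = cyc (Suc (i + n - 1))" using n3 by (simp add: cyc_def)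
  then show ?thesis by blast
qed

lemma D_eq_2: "D = 2"
proof -
  obtain u where u: "u \<in> pverts G" "card (nbrs u) = D" using degree_attained by blast
  then obtain i where "u = cyc (Suc i)" using verts_cyc by blast
  then show ?thesis using u(2) cyc_nbrs[of i] by simp
qed

lemma adjacent: "cyc (Suc i) \<in> nbrs (cyc i)" "cyc i \<in> nbrs (cyc (Suc i))"
  using cyc_nbrs[of i] nbrs_sym by auto

lemma step_gain_nonzero: "step_gain i \<noteq> 0"
  unfolding step_gain_def by (rule gain_nonzero[OF adjacent(1)])

lemma walk_gain_nonzero: "walk_gain i \<noteq> 0"
  by (simp add: walk_gain_def step_gain_nonzero)

lemma walk_gain_Suc: "walk_gain (Suc i) = walk_gain i * step_gain i"
  by (simp add: walk_gain_def)

lemma walk_gain_n: "walk_gain n = total"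
  unfolding walk_gain_def cycle_gain_def
  by (intro prod.cong) (auto simp: step_gain_def cyc_def)

lemma cyc_shift: "cyc (i + n) = cyc i"
  by (simp add: cyc_def)

lemma walk_gain_shift: "walk_gain (i + n) = total * walk_gain i"
proof (induction i)
  case 0
  then show ?case by (simp add: walk_gain_n) (simp add: walk_gain_def)
next
  case (Suc i)
  have "step_gain (i + n) = step_gain i"
    using cyc_shift[of i] cyc_shift[of "Suc i"] by (simp add: step_gain_def)
  then show ?case using Suc by (simp add: walk_gain_Suc)
qed

lemma lift_shift: "lift x (i + n) = total * lift x i"
  by (simp add: lift_def walk_gain_shift cyc_shift)

lemma eigenfunction_iff_lift_recurrence:
  "eigenfunction \<alpha> lam x \<longleftrightarrow> (\<forall>i. lift x (Suc (Suc i)) = ratio lam * lift x (Suc i) - lift x i)"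
proof -
  have b: "complex_of_real (1 - \<alpha>) \<noteq> 0" using \<alpha>_less_1 by (simp del: of_real_diff)
  define b where "b = complex_of_real (1 - \<alpha>)"
  have b0: "b \<noteq> 0" using b by (simp add: b_def)
  have ratio: "b * ratio lam = lam - 2 * of_real \<alpha>"
    using b0 by (simp add: ratio_def b_def[symmetric] del: of_real_diff)
  have row: "of_real \<alpha> * of_nat (card (nbrs (cyc (Suc i)))) * x (cyc (Suc i))
      + b * (\<Sum>w\<in>nbrs (cyc (Suc i)). \<phi> (cyc (Suc i), w) * x w) = lam * x (cyc (Suc i))
    \<longleftrightarrow> lift x (Suc (Suc i)) = ratio lam * lift x (Suc i) - lift x i" (is "?L = ?r \<longleftrightarrow> ?rec") for i
  proof -
    let ?p = "walk_gain (Suc i)" and ?u = "cyc (Suc i)"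
    have inverse: "step_gain i * \<phi> (?u, cyc i) = 1"
      using gain_inverse[of "cyc (Suc i)" "cyc i"] adjacent(2)[of i] step_gain_nonzero[of i]
      by (simp add: nbrs_def step_gain_def)
    have fwd: "?p * (\<phi> (?u, cyc (Suc (Suc i))) * x (cyc (Suc (Suc i)))) = lift x (Suc (Suc i))"
      by (simp add: lift_def walk_gain_Suc step_gain_def)
    have bwd: "?p * (\<phi> (?u, cyc i) * x (cyc i)) = lift x i"
      using inverse by (simp add: lift_def walk_gain_Suc mult.assoc mult.left_commute)
    have sum: "?p * (\<Sum>w\<in>nbrs ?u. \<phi> (?u, w) * x w) = lift x (Suc (Suc i)) + lift x i"
      using cyc_nbrs[of i] fwd bwd by (simp add: distrib_left)
    have card: "card (nbrs ?u) = 2" using cyc_nbrs[of i] by simp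
    have "?L = ?r \<longleftrightarrow> ?p * ?L = ?p * ?r" using walk_gain_nonzero[of "Suc i"] by simp
    also have "?p * ?L = 2 * of_real \<alpha> * lift x (Suc i) + b * (lift x (Suc (Suc i)) + lift x i)"
      unfolding card sum[symmetric] by (simp add: lift_def algebra_simps)
    also have "?p * ?r = lam * lift x (Suc i)" by (simp add: lift_def algebra_simps)
    also have "2 * of_real \<alpha> * lift x (Suc i) + b * (lift x (Suc (Suc i)) + lift x i) = lam * lift x (Suc i)
        \<longleftrightarrow> b * lift x (Suc (Suc i)) = (lam - 2 * of_real \<alpha>) * lift x (Suc i) - b * lift x i"
      by (auto simp: algebra_simps)
    also have "(lam - 2 * of_real \<alpha>) * lift x (Suc i) - b * lift x i
        = b * (ratio lam * lift x (Suc i) - lift x i)"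
      by (simp only: ratio[symmetric] right_diff_distrib mult.assoc)
    finally show ?thesis using b0 by simp
  qed
  have "eigenfunction \<alpha> lam x \<longleftrightarrow> (\<forall>i. of_real \<alpha> * of_nat (card (nbrs (cyc (Suc i)))) * x (cyc (Suc i))
      + b * (\<Sum>w\<in>nbrs (cyc (Suc i)). \<phi> (cyc (Suc i), w) * x w) = lam * x (cyc (Suc i)))"
  proof -
    have "pverts G = range (\<lambda>i. cyc (Suc i))" using verts_cyc cyc_mem by auto
    then show ?thesis unfolding eigenfunction_def b_def by simp
  qed
  then show ?thesis using row by simp
qed

lemma quasiperiodic_is_lift:
  assumes y: "\<And>i. y (i + n) = total * y i"
  obtains x where "lift x = y"
proof -
  define x where "x u = y (the_inv_into {..<n} c u) / walk_gain (the_inv_into {..<n} c u)" for u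
  have multiples: "f (r + q * n) = total ^ q * f r" if "\<And>i. f (i + n) = total * f i" for f r q
  proof (induction q)
    case (Suc q)
    have "f (r + Suc q * n) = f ((r + q * n) + n)" by (simp add: algebra_simps)
    then show ?case using Suc that by simp
  qed simp
  have "lift x i = y i" for i
  proof -
    let ?r = "i mod n" and ?q = "i div n"
    have "the_inv_into {..<n} c (cyc i) = ?r"
      using bij_c n3 by (auto simp: cyc_def bij_betw_def the_inv_into_f_f)
    then have "lift x i = walk_gain i * (y ?r / walk_gain ?r)" by (simp add: lift_def x_def)
    moreover have "walk_gain i = total ^ ?q * walk_gain ?r" "y i = total ^ ?q * y ?r"
      using multiples[of walk_gain ?r ?q, OF walk_gain_shift] multiples[of y ?r ?q, OF y] by simp_all
    ultimately show ?thesis using walk_gain_nonzero[of ?r] by simp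
  qed
  then show ?thesis using that by blast
qed

lemma lift_0: "lift x 0 = x (cyc 0)"
  by (simp add: lift_def walk_gain_def)

lemma lift_1: "lift x 1 = step_gain 0 * x (cyc 1)"
  by (simp add: lift_def walk_gain_def)

lemma cyc_0_neq_1: "cyc 0 \<noteq> cyc 1"
  using adjacent(1)[of 0] not_own_nbr by (metis One_nat_def)

text \<open>
  The lifts \<open>sin ((1 - i)\<theta>) / sin \<theta>\<close> and (up to a unit) \<open>sin (i\<theta>) / sin \<theta>\<close> are dual to the first two vertices.
\<close>
lemma mult_ge_2:
  assumes sin: "sin \<theta> \<noteq> 0" and period: "sin (real n * \<theta>) = 0" "total = of_real (cos (real n * \<theta>))"
    and lam: "lam = of_real (2 * \<alpha> + 2 * (1 - \<alpha>) * cos \<theta>)"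
  shows "2 \<le> mult lam"
proof -
  have b: "complex_of_real (1 - \<alpha>) \<noteq> 0" using \<alpha>_less_1 by (simp del: of_real_diff)
  have "lam - 2 * of_real \<alpha> = of_real (1 - \<alpha>) * of_real (2 * cos \<theta>)" by (simp add: lam algebra_simps)
  then have ratio: "ratio lam = of_real (2 * cos \<theta>)" using b by (simp add: ratio_def del: of_real_diff)
  have wave: "\<exists>x. eigenfunction \<alpha> lam x \<and> (\<forall>i. lift x i = a * of_real (sin (real i * \<theta> + \<delta>)))" for a \<delta>
  proof -
    define y where "y i = a * of_real (sin (real i * \<theta> + \<delta>))" for i
    have "y (i + n) = total * y i" for i
    proof -
      have "sin (real (i + n) * \<theta> + \<delta>) = sin ((real i * \<theta> + \<delta>) + real n * \<theta>)"
        by (simp add: algebra_simps)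
      also have "\<dots> = cos (real n * \<theta>) * sin (real i * \<theta> + \<delta>)"
        unfolding sin_add period by simp
      finally show ?thesis by (simp add: y_def period)
    qed
    then obtain x where x: "lift x = y" using quasiperiodic_is_lift by blast
    have "sin (real (Suc (Suc i)) * \<theta> + \<delta>)
        = 2 * cos \<theta> * sin (real (Suc i) * \<theta> + \<delta>) - sin (real i * \<theta> + \<delta>)" for i
    proof -
      let ?m = "real (Suc i) * \<theta> + \<delta>"
      have "sin (?m + \<theta>) + sin (?m - \<theta>) = 2 * cos \<theta> * sin ?m"
        by (simp add: sin_add sin_diff)
      moreover have "?m + \<theta> = real (Suc (Suc i)) * \<theta> + \<delta>" "?m - \<theta> = real i * \<theta> + \<delta>"
        by (simp_all add: algebra_simps)
      ultimately have "sin (real (Suc (Suc i)) * \<theta> + \<delta>) + sin (real i * \<theta> + \<delta>) = 2 * cos \<theta> * sin ?m"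
        by metis
      then show ?thesis by linarith
    qed
    then have "y (Suc (Suc i)) = ratio lam * y (Suc i) - y i" for i
      by (simp add: y_def ratio right_diff_distrib mult.left_commute[of a])
    then have "eigenfunction \<alpha> lam x" by (simp add: eigenfunction_iff_lift_recurrence x)
    moreover have "lift x i = a * of_real (sin (real i * \<theta> + \<delta>))" for i
      by (simp add: x y_def)
    ultimately show ?thesis by blast
  qed
  have "card {cyc 0, cyc 1} \<le> mult lam"
  proof (rule card_le_eigenvalue_mult)
    show "{cyc 0, cyc 1} \<subseteq> pverts G" using cyc_mem by blast
    obtain x where x: "eigenfunction \<alpha> lam x"
      "\<And>i. lift x i = - inverse (of_real (sin \<theta>)) * of_real (sin (real i * \<theta> + - \<theta>))"
      using wave by metis
    then have x': "x (cyc 0) = 1" "x (cyc 1) = 0"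
      using lift_0[of x] lift_1[of x] sin step_gain_nonzero[of 0] by simp_all
    obtain x2 where x2: "eigenfunction \<alpha> lam x2"
      "\<And>i. lift x2 i = step_gain 0 * inverse (of_real (sin \<theta>)) * of_real (sin (real i * \<theta> + 0))"
      using wave by metis
    then have x2': "x2 (cyc 0) = 0" "x2 (cyc 1) = 1"
      using lift_0[of x2] lift_1[of x2] sin step_gain_nonzero[of 0] by simp_all
    show "\<exists>x. eigenfunction \<alpha> lam x \<and> x z = 1 \<and> (\<forall>z' \<in> {cyc 0, cyc 1} - {z}. x z' = 0)"
      if "z \<in> {cyc 0, cyc 1}" for z
      using that x x' x2 x2' by blast
  qed
  then show ?thesis using cyc_0_neq_1 by simp
qed

text \<open>
  In an eigenspace of dimension at least 2 some nonzero function vanishes at the first vertex, and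
  the recurrence determines its lift up to scaling.
\<close>
lemma mult_2_imp_standing_wave:
  assumes "2 \<le> mult lam"
  obtains \<theta> where "0 < \<theta>" "\<theta> < pi" "lam = of_real (2 * \<alpha> + 2 * (1 - \<alpha>) * cos \<theta>)"
    "total = 1 \<and> cos (real n * \<theta>) = 1 \<or> total = - 1 \<and> cos (real n * \<theta>) = - 1"
proof -
  have b: "complex_of_real (1 - \<alpha>) \<noteq> 0" using \<alpha>_less_1 by (simp del: of_real_diff)
  have "{cyc 0} \<subseteq> pverts G" "card {cyc 0} < mult lam" using assms cyc_mem by auto
  then obtain x where x: "eigenfunction \<alpha> lam x" "\<And>z. z \<in> {cyc 0} \<Longrightarrow> x z = 0"
    and nonzero: "\<exists>u \<in> pverts G. x u \<noteq> 0"
    by (rule eigenfunction_vanishing_on) (rule that)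
  have rec: "lift x (Suc (Suc i)) = ratio lam * lift x (Suc i) - lift x i" for i
    using x(1) eigenfunction_iff_lift_recurrence by blast
  have lift0: "lift x 0 = 0" using x(2) by (simp add: lift_0)
  have lift1: "lift x 1 \<noteq> 0"
  proof
    assume zero: "lift x 1 = 0"
    have "lift x i = 0 \<and> lift x (Suc i) = 0" for i
      by (induction i) (use lift0 zero rec in auto)
    then have "x (cyc i) = 0" for i
      using walk_gain_nonzero[of i] by (auto simp: lift_def)
    then show False using nonzero verts_cyc by metis
  qed
  define s where "s i = lift x i / lift x 1" for i
  have "s 0 = 0" "s 1 = 1" using lift0 lift1 by (simp_all add: s_def)
  moreover have "s (Suc (Suc i)) = ratio lam * s (Suc i) - s i" for i
    by (simp add: s_def rec diff_divide_distrib)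
  moreover have "s (i + n) = total * s i" for i by (simp add: s_def lift_shift)
  ultimately obtain \<theta> where \<theta>: "0 < \<theta>" "\<theta> < pi" "ratio lam = of_real (2 * cos \<theta>)"
    "total = 1 \<and> cos (real n * \<theta>) = 1 \<or> total = - 1 \<and> cos (real n * \<theta>) = - 1"
    using quasiperiodic_chebyshev[of s "ratio lam" n total] n3 by auto
  have "lam - 2 * of_real \<alpha> = of_real (1 - \<alpha>) * of_real (2 * cos \<theta>)"
    using \<theta>(3) b by (simp add: ratio_def field_simps del: of_real_diff)
  then have "lam = of_real (2 * \<alpha> + 2 * (1 - \<alpha>) * cos \<theta>)" by (simp add: algebra_simps)
  then show ?thesis using that \<theta> by blast
qed

end

section \<open>The extremal case\<close>

lemma cos_multiple_eq_1_iff: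
  fixes \<theta> :: real
  assumes n: "0 < n"
  shows "0 < \<theta> \<and> \<theta> < pi \<and> cos (real n * \<theta>) = 1 \<longleftrightarrow>
    (\<exists>j::int. 1 \<le> j \<and> j \<le> \<lceil>real n / 2\<rceil> - 1 \<and> \<theta> = 2 * pi * of_int j / real n)"
proof -
  have "cos (real n * \<theta>) = 1 \<longleftrightarrow> (\<exists>j::int. \<theta> = 2 * pi * of_int j / real n)"
    using n by (simp add: cos_one_2pi_int field_simps)
  moreover have "0 < 2 * pi * of_int j / real n \<longleftrightarrow> 1 \<le> j" for j :: int
    using n by (auto simp: zero_less_divide_iff zero_less_mult_iff)
  moreover have "2 * pi * of_int j / real n < pi \<longleftrightarrow> j \<le> \<lceil>real n / 2\<rceil> - 1" for j :: int
  proof -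
    have "2 * pi * of_int j / real n < pi \<longleftrightarrow> pi * (2 * of_int j) < pi * real n"
      using n by (simp add: field_simps)
    also have "\<dots> \<longleftrightarrow> real_of_int j < real n / 2" by (simp add: field_simps)
    also have "\<dots> \<longleftrightarrow> j \<le> \<lceil>real n / 2\<rceil> - 1"
      unfolding less_ceiling_iff[symmetric] by linarith
    finally show ?thesis .
  qed
  ultimately show ?thesis by metis
qed

lemma cos_multiple_eq_minus_1_iff:
  fixes \<theta> :: real
  assumes n: "0 < n"
  shows "0 < \<theta> \<and> \<theta> < pi \<and> cos (real n * \<theta>) = - 1 \<longleftrightarrow>
    (\<exists>j::int. 0 \<le> j \<and> j \<le> \<lfloor>real n / 2\<rfloor> - 1 \<and> \<theta> = (2 * of_int j + 1) * pi / real n)"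
proof -
  have "cos (real n * \<theta>) = - 1 \<longleftrightarrow> cos (real n * \<theta> - pi) = 1" by (simp add: cos_diff)
  also have "\<dots> \<longleftrightarrow> (\<exists>j::int. \<theta> = (2 * of_int j + 1) * pi / real n)"
    unfolding cos_one_2pi_int using n by (simp add: field_simps)
  finally have 1: "cos (real n * \<theta>) = - 1 \<longleftrightarrow> (\<exists>j::int. \<theta> = (2 * of_int j + 1) * pi / real n)" .
  have 2: "0 < (2 * of_int j + 1) * pi / real n \<longleftrightarrow> 0 \<le> j" for j :: int
  proof -
    have "0 < (2 * of_int j + 1) * pi / real n \<longleftrightarrow> 0 < 2 * real_of_int j + 1"
      using n by (simp add: zero_less_divide_iff zero_less_mult_iff)
    then show ?thesis by linarith
  qed
  have 3: "(2 * of_int j + 1) * pi / real n < pi \<longleftrightarrow> j \<le> \<lfloor>real n / 2\<rfloor> - 1" for j :: int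
  proof -
    have "(2 * of_int j + 1) * pi / real n < pi \<longleftrightarrow> pi * (2 * of_int j + 1) < pi * real n"
      using n by (simp add: field_simps)
    also have "\<dots> \<longleftrightarrow> 2 * real_of_int j + 1 < real n" by simp
    also have "\<dots> \<longleftrightarrow> 2 * j + 1 < int n" by linarith
    also have "\<dots> \<longleftrightarrow> 2 * (j + 1) \<le> int n" by presburger
    also have "\<dots> \<longleftrightarrow> real_of_int (2 * (j + 1)) \<le> real_of_int (int n)"
      by (simp only: of_int_le_iff)
    also have "\<dots> \<longleftrightarrow> real_of_int (j + 1) \<le> real n / 2" by auto
    also have "\<dots> \<longleftrightarrow> j + 1 \<le> \<lfloor>real n / 2\<rfloor>" by (simp only: le_floor_iff)
    finally show ?thesis by linarith
  qed
  show ?thesis unfolding 1 using 2 3 by metis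
qed

context gain_graph_spectrum
begin

text \<open>
  Equality in the bound, in the form free of division.
\<close>
abbreviation extremal :: "complex \<Rightarrow> bool" where
  "extremal lam \<equiv> (D - 1) * mult lam + n = (D - 1) * n + 2"

lemma real_bound_iff:
  "real (mult lam) \<le> ((real D - 2) * real n + 2) / (real D - 1)"
  "real (mult lam) = ((real D - 2) * real n + 2) / (real D - 1) \<longleftrightarrow> extremal lam"
proof -
  have D: "real (D - 1) = real D - 1" "0 < real D - 1" using D_ge_2 by auto
  have "(real D - 1) * real (mult lam) + real n \<le> (real D - 1) * real n + 2"
    using mult_bound[of lam] unfolding D(1)[symmetric] of_nat_mult[symmetric] of_nat_add[symmetric]
    by linarith
  then show "real (mult lam) \<le> ((real D - 2) * real n + 2) / (real D - 1)"
    using D(2) by (simp add: pos_le_divide_eq algebra_simps)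
  have "extremal lam \<longleftrightarrow> real ((D - 1) * mult lam + n) = real ((D - 1) * n + 2)"
    by linarith
  also have "\<dots> \<longleftrightarrow> (real D - 1) * real (mult lam) + real n = (real D - 1) * real n + 2"
    unfolding of_nat_add of_nat_mult D(1) by simp
  also have "\<dots> \<longleftrightarrow> real (mult lam) = ((real D - 2) * real n + 2) / (real D - 1)"
    using D(2) by (simp add: eq_divide_eq) (auto simp: algebra_simps)
  finally show "real (mult lam) = ((real D - 2) * real n + 2) / (real D - 1) \<longleftrightarrow> extremal lam" ..
qed

lemma complete_digraph_iff:
  "K\<^bsub>n\<^esub> (with_proj G) \<longleftrightarrow> (\<forall>u \<in> pverts G. nbrs u = pverts G - {u})"
proof -
  have "parcs G = {(u, w). (u, w) \<in> pverts G \<times> pverts G \<and> u \<noteq> w}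
      \<longleftrightarrow> (\<forall>u \<in> pverts G. nbrs u = pverts G - {u})"
    using in_arcsD1 unfolding nbrs_def by (auto simp: Set.set_eq_iff)
  then show ?thesis
    unfolding complete_digraph_pair_def using pair_finite_verts card_verts by simp
qed

lemma complete_extremal_iff:
  assumes complete: "\<And>u. u \<in> pverts G \<Longrightarrow> nbrs u = pverts G - {u}"
  shows "extremal lam \<longleftrightarrow> (\<exists>\<kappa>. eigenvalue (gain_adj_mat G \<phi> n v) \<kappa>
    \<and> eigenvalue_mult (gain_adj_mat G \<phi> n v) \<kappa> = n - 1
    \<and> lam = of_real (\<alpha> * (real n - 1)) + of_real (1 - \<alpha>) * \<kappa>)"
proof -
  let ?A = "gain_adj_mat G \<phi> n v"
  obtain u where u: "u \<in> pverts G" "card (nbrs u) = D" using degree_attained by blast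
  then have n: "n = Suc D"
    using complete[OF u(1)] pair_finite_verts card_verts card_Suc_Diff1 by metis
  have "(D - 1) * n + 2 = (D - 1) * D + n" using n D_ge_2 by (simp add: algebra_simps)
  then have ext: "extremal lam \<longleftrightarrow> mult lam = n - 1" using n D_ge_2 by simp
  have b: "complex_of_real (1 - \<alpha>) \<noteq> 0" using \<alpha>_less_1 by (simp del: of_real_diff)
  define \<kappa> where "\<kappa> = (lam - of_real (\<alpha> * (real n - 1))) / of_real (1 - \<alpha>)"
  have lam: "lam = of_real (\<alpha> * (real n - 1)) + of_real (1 - \<alpha>) * \<kappa>"
    using b by (simp add: \<kappa>_def del: of_real_diff)
  have mult: "mult lam = eigenvalue_mult ?A \<kappa>" unfolding lam by (rule mult_complete[OF complete])
  have carrier: "?A \<in> carrier_mat n n" by (simp add: gain_adj_mat_def)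
  have "eigenvalue ?A \<kappa>" if "mult lam = n - 1"
  proof -
    have "Polynomial.order \<kappa> (char_poly ?A) \<noteq> 0" using that mult n D_ge_2 by (simp add: eigenvalue_mult_def)
    then show ?thesis using eigenvalue_root_char_poly[OF carrier] order_root by blast
  qed
  moreover have "\<kappa>' = \<kappa>" if "lam = of_real (\<alpha> * (real n - 1)) + of_real (1 - \<alpha>) * \<kappa>'" for \<kappa>'
    using that b by (simp add: \<kappa>_def del: of_real_diff)
  ultimately show ?thesis unfolding ext using lam mult by metis
qed

lemma cycle_extremal_iff:
  assumes c: "cycle_traversal n G c"
  shows "extremal lam \<longleftrightarrow> (\<exists>\<theta>. 0 < \<theta> \<and> \<theta> < pi \<and> lam = of_real (2 * \<alpha> + 2 * (1 - \<alpha>) * cos \<theta>) \<and>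
    (cycle_gain n \<phi> c = 1 \<and> cos (real n * \<theta>) = 1 \<or> cycle_gain n \<phi> c = - 1 \<and> cos (real n * \<theta>) = - 1))"
proof -
  interpret C: cycle_gain_graph_spectrum G \<phi> n v D \<alpha> c
    by unfold_locales (rule c)
  have ext: "extremal lam \<longleftrightarrow> 2 \<le> mult lam"
    using mult_bound[of lam] C.D_eq_2 by auto
  show ?thesis
  proof
    assume "extremal lam"
    then have "2 \<le> mult lam" using ext by simp
    then show "\<exists>\<theta>. 0 < \<theta> \<and> \<theta> < pi \<and> lam = of_real (2 * \<alpha> + 2 * (1 - \<alpha>) * cos \<theta>) \<and>
      (cycle_gain n \<phi> c = 1 \<and> cos (real n * \<theta>) = 1 \<or> cycle_gain n \<phi> c = - 1 \<and> cos (real n * \<theta>) = - 1)"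
      by (rule C.mult_2_imp_standing_wave) blast
  next
    assume "\<exists>\<theta>. 0 < \<theta> \<and> \<theta> < pi \<and> lam = of_real (2 * \<alpha> + 2 * (1 - \<alpha>) * cos \<theta>) \<and>
      (cycle_gain n \<phi> c = 1 \<and> cos (real n * \<theta>) = 1 \<or> cycle_gain n \<phi> c = - 1 \<and> cos (real n * \<theta>) = - 1)"
    then obtain \<theta> where \<theta>: "0 < \<theta>" "\<theta> < pi" "lam = of_real (2 * \<alpha> + 2 * (1 - \<alpha>) * cos \<theta>)"
      and gain: "cycle_gain n \<phi> c = of_real (cos (real n * \<theta>))"
      and cos: "cos (real n * \<theta>) = 1 \<or> cos (real n * \<theta>) = - 1" by auto
    have "sin (real n * \<theta>) = 0"
      using cos sin_squared_eq[of "real n * \<theta>"] by auto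
    moreover have "sin \<theta> \<noteq> 0" using sin_gt_zero[OF \<theta>(1,2)] by simp
    ultimately show "extremal lam" using C.mult_ge_2 gain \<theta>(3) ext by blast
  qed
qed

lemma complete_bipartite_digraph_iff:
  "even n \<and> K\<^bsub>n div 2,n div 2\<^esub> (with_proj G)
    \<longleftrightarrow> (\<exists>X Y. bipartite_gain_graph_spectrum G \<phi> n v D \<alpha> X Y)"
proof
  assume "even n \<and> K\<^bsub>n div 2,n div 2\<^esub> (with_proj G)"
  then obtain X Y where parts: "pverts G = X \<union> Y" "X \<inter> Y = {}" "card X = n div 2" "card Y = n div 2"
    and arcs: "parcs G = X \<times> Y \<union> Y \<times> X"
    by (auto simp: complete_bipartite_digraph_pair_def)
  have X: "nbrs x = Y" if "x \<in> X" for x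
    using that parts(2) unfolding nbrs_def arcs by blast
  have Y: "nbrs y = X" if "y \<in> Y" for y
    using that parts(2) unfolding nbrs_def arcs by blast
  obtain u where u: "u \<in> X \<union> Y" "card (nbrs u) = D" using degree_attained parts(1) by metis
  then have D: "n div 2 = D"
    using X Y parts(3,4) by (metis UnE)
  have "bipartite_gain_graph_spectrum G \<phi> n v D \<alpha> X Y"
    by unfold_locales (use parts X Y D in simp_all)
  then show "\<exists>X Y. bipartite_gain_graph_spectrum G \<phi> n v D \<alpha> X Y" by blast
next
  assume "\<exists>X Y. bipartite_gain_graph_spectrum G \<phi> n v D \<alpha> X Y"
  then obtain X Y where B: "bipartite_gain_graph_spectrum G \<phi> n v D \<alpha> X Y" by blast
  interpret B: bipartite_gain_graph_spectrum G \<phi> n v D \<alpha> X Y by (rule B)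
  have "(a, b) \<in> parcs G \<longleftrightarrow> (a, b) \<in> X \<times> Y \<union> Y \<times> X" for a b
  proof -
    have "(a, b) \<in> parcs G \<longleftrightarrow> a \<in> X \<union> Y \<and> b \<in> nbrs a"
      using in_arcsD1 B.parts(1) unfolding nbrs_def by blast
    then show ?thesis using B.nbrs_X[of a] B.nbrs_Y[of a] B.parts(2) by auto
  qed
  then have "parcs G = X \<times> Y \<union> Y \<times> X" by auto
  then show "even n \<and> K\<^bsub>n div 2,n div 2\<^esub> (with_proj G)"
    using B.parts pair_finite_verts B.n_eq by (auto simp: complete_bipartite_digraph_pair_def)
qed

lemma bipartite_extremal_iff:
  assumes "bipartite_gain_graph_spectrum G \<phi> n v D \<alpha> X Y"
  shows "extremal lam \<longleftrightarrow> mult lam + 2 = n"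
proof -
  interpret B: bipartite_gain_graph_spectrum G \<phi> n v D \<alpha> X Y by (rule assms)
  obtain d where d: "D = Suc (Suc d)" using D_ge_2 by (metis Suc_le_D numeral_2_eq_2 Suc_le_mono)
  have "(D - 1) * n + 2 = (D - 1) * (n - 2) + n"
    unfolding B.n_eq d by (simp add: algebra_simps)
  then have "extremal lam \<longleftrightarrow> (D - 1) * mult lam = (D - 1) * (n - 2)" by (simp only: add_right_cancel)
  then have "extremal lam \<longleftrightarrow> mult lam = n - 2" using D_ge_2 by simp
  then show "extremal lam \<longleftrightarrow> mult lam + 2 = n" using B.n_eq d by auto

qed

text \<open>
  The cases overlap: the triangle is both complete and a cycle. The restriction \<open>3 \<le> D\<close> in
  the bipartite case keeps out the 4-cycle, where extremality does not force \<open>\<lambda> = \<alpha>D\<close>.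
\<close>
lemma extremal_graph_classification:
  assumes "extremal lam"
  shows "(\<forall>u \<in> pverts G. nbrs u = pverts G - {u}) \<or> (\<exists>c. cycle_traversal n G c) \<or>
    3 \<le> D \<and> (\<exists>X Y. bipartite_gain_graph_spectrum G \<phi> n v D \<alpha> X Y)"
proof -
  have tight: tight by (rule mult_extremal_imp_tight[OF assms])
  consider "D = 2" | "3 \<le> D" "\<exists>u w. u \<in> pverts G \<and> w \<in> nbrs u \<and> nbrs u \<inter> nbrs w \<noteq> {}"
    | "3 \<le> D" "\<And>u w. u \<in> pverts G \<Longrightarrow> w \<in> nbrs u \<Longrightarrow> nbrs u \<inter> nbrs w = {}"
    using D_ge_2 by force
  then show ?thesis
  proof cases
    case 1
    then show ?thesis
      using two_regular_imp_cycle tight_regular[OF tight] card_verts by metis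
  next
    case 2
    then show ?thesis using tight_triangle_imp_complete[OF tight] by blast
  next
    case 3
    obtain X Y where "pverts G = X \<union> Y" "X \<inter> Y = {}" "card X = D" "card Y = D"
      "\<forall>x\<in>X. nbrs x = Y" "\<forall>y\<in>Y. nbrs y = X"
      using tight_triangle_free_imp_bipartite[OF tight 3] by blast
    then have "bipartite_gain_graph_spectrum G \<phi> n v D \<alpha> X Y"
      by unfold_locales simp_all
    then show ?thesis using 3(1) by blast
  qed
qed

end

theorem theorem3p1:
  fixes G :: "'a pair_pre_digraph" and \<phi> :: "'a \<times> 'a \<Rightarrow> complex"
    and n \<Delta> :: nat and v :: "nat \<Rightarrow> 'a" and \<alpha> :: real and lam :: complex and m :: nat
  assumes "gain_graph G \<phi>"
    and "Digraph_Component.connected (with_proj G)"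
    and "bij_betw v {..<n} (pverts G)"
    and "\<Delta> = max_degree G" and "2 \<le> \<Delta>"
    and "0 \<le> \<alpha>" and "\<alpha> < 1"
    and "m = eigenvalue_mult (A_alpha \<alpha> G \<phi> n v) lam"
  shows "real m \<le> ((real \<Delta> - 2) * real n + 2) / (real \<Delta> - 1)
    \<and> (real m = ((real \<Delta> - 2) * real n + 2) / (real \<Delta> - 1) \<longleftrightarrow>
        K\<^bsub>n\<^esub> (with_proj G)
          \<and> (\<exists>\<mu>. eigenvalue (gain_adj_mat G \<phi> n v) \<mu>
                \<and> eigenvalue_mult (gain_adj_mat G \<phi> n v) \<mu> = n - 1
                \<and> lam = complex_of_real (\<alpha> * (real n - 1)) + complex_of_real (1 - \<alpha>) * \<mu>)
      \<or> cycle_with_gain n G \<phi> 1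
          \<and> lam \<in> {complex_of_real (2 * \<alpha> + 2 * (1 - \<alpha>) * cos (2 * pi * of_int j / real n)) | j :: int.
                    1 \<le> j \<and> j \<le> \<lceil>real n / 2\<rceil> - 1}
      \<or> cycle_with_gain n G \<phi> (- 1)
          \<and> lam \<in> {complex_of_real (2 * \<alpha> + 2 * (1 - \<alpha>) * cos ((2 * of_int j + 1) * pi / real n)) | j :: int.
                    0 \<le> j \<and> j \<le> \<lfloor>real n / 2\<rfloor> - 1}
      \<or> even n \<and> K\<^bsub>n div 2,n div 2\<^esub> (with_proj G)
          \<and> switching_equivalent G \<phi> (\<lambda>_. 1)
          \<and> lam = complex_of_real (\<alpha> * real n / 2))"
    (is "?bound \<and> (?equality \<longleftrightarrow> ?complete \<or> ?cycle1 \<or> ?cycle2 \<or> ?bipartite)")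
proof -
  interpret gain_graph G \<phi> by fact
  have nonempty: "pverts G \<noteq> {}" using assms(2) by (simp add: connected_conv)
  have degrees: "\<Delta> = Max ((\<lambda>u. card (nbrs u)) ` pverts G)"
    using assms(4) by (simp add: max_degree_def out_degree_eq_card_nbrs)
  interpret gain_graph_spectrum G \<phi> n v \<Delta> \<alpha>
  proof unfold_locales
    show "card (nbrs u) \<le> \<Delta>" if "u \<in> pverts G" for u
      using that pair_finite_verts unfolding degrees by (intro Max_ge) auto
    have "\<Delta> \<in> (\<lambda>u. card (nbrs u)) ` pverts G"
      unfolding degrees using nonempty pair_finite_verts by (intro Max_in) auto
    then show "\<exists>u \<in> pverts G. card (nbrs u) = \<Delta>" by blast
  qed (fact assms)+
  have m: "m = mult lam" by fact
  have n: "0 < n" using nonempty card_verts pair_finite_verts card_gt_0_iff by metis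
  let ?lam = "\<lambda>\<theta>. complex_of_real (2 * \<alpha> + 2 * (1 - \<alpha>) * cos \<theta>)"
  have cycle1: "?cycle1 \<longleftrightarrow> (\<exists>c \<theta>. cycle_traversal n G c \<and> cycle_gain n \<phi> c = 1 \<and>
      0 < \<theta> \<and> \<theta> < pi \<and> cos (real n * \<theta>) = 1 \<and> lam = ?lam \<theta>)"
  proof -
    have "lam \<in> {?lam (2 * pi * of_int j / real n) | j :: int. 1 \<le> j \<and> j \<le> \<lceil>real n / 2\<rceil> - 1}
        \<longleftrightarrow> (\<exists>\<theta>. (0 < \<theta> \<and> \<theta> < pi \<and> cos (real n * \<theta>) = 1) \<and> lam = ?lam \<theta>)"
      unfolding cos_multiple_eq_1_iff[OF n] by blast
    then show ?thesis unfolding cycle_with_gain_def by auto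
  qed
  have cycle2: "?cycle2 \<longleftrightarrow> (\<exists>c \<theta>. cycle_traversal n G c \<and> cycle_gain n \<phi> c = - 1 \<and>
      0 < \<theta> \<and> \<theta> < pi \<and> cos (real n * \<theta>) = - 1 \<and> lam = ?lam \<theta>)"
  proof -
    have "lam \<in> {?lam ((2 * of_int j + 1) * pi / real n) | j :: int. 0 \<le> j \<and> j \<le> \<lfloor>real n / 2\<rfloor> - 1}
        \<longleftrightarrow> (\<exists>\<theta>. (0 < \<theta> \<and> \<theta> < pi \<and> cos (real n * \<theta>) = - 1) \<and> lam = ?lam \<theta>)"
      unfolding cos_multiple_eq_minus_1_iff[OF n] by blast
    then show ?thesis unfolding cycle_with_gain_def by auto
  qed
  have middle: "complex_of_real (\<alpha> * real n / 2) = of_real \<alpha> * of_nat \<Delta>"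
    if "bipartite_gain_graph_spectrum G \<phi> n v \<Delta> \<alpha> X Y" for X Y
    using bipartite_gain_graph_spectrum.n_eq[OF that] by simp
  have "extremal lam \<longleftrightarrow> ?complete \<or> ?cycle1 \<or> ?cycle2 \<or> ?bipartite"
  proof
    assume ext: "extremal lam"
    from extremal_graph_classification[OF ext]
    consider "\<And>u. u \<in> pverts G \<Longrightarrow> nbrs u = pverts G - {u}" | c where "cycle_traversal n G c"
      | X Y where "3 \<le> \<Delta>" "bipartite_gain_graph_spectrum G \<phi> n v \<Delta> \<alpha> X Y"
      by blast
    then show "?complete \<or> ?cycle1 \<or> ?cycle2 \<or> ?bipartite"
    proof cases
      case 1
      then have ?complete using ext complete_extremal_iff[OF 1] complete_digraph_iff by blast
      then show ?thesis by blast
    next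
      case 2
      then have "?cycle1 \<or> ?cycle2"
        unfolding cycle1 cycle2 using ext cycle_extremal_iff[OF 2] by blast
      then show ?thesis by blast
    next
      case 3
      interpret B: bipartite_gain_graph_spectrum G \<phi> n v \<Delta> \<alpha> X Y by (rule 3(2))
      have "mult lam + 2 = n" using ext bipartite_extremal_iff[OF 3(2)] by blast
      then have ?bipartite
        using B.extremal_eigenvalue[OF 3(1)] B.extremal_switching_trivial middle[OF 3(2)]
          complete_bipartite_digraph_iff 3(2) by metis
      then show ?thesis by blast
    qed
  next
    assume "?complete \<or> ?cycle1 \<or> ?cycle2 \<or> ?bipartite"
    then consider ?complete | "?cycle1 \<or> ?cycle2" | ?bipartite by blast
    then show "extremal lam"
    proof cases
      case 1
      then have "\<And>u. u \<in> pverts G \<Longrightarrow> nbrs u = pverts G - {u}" using complete_digraph_iff by blast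
      from complete_extremal_iff[OF this] show ?thesis using 1 by blast
    next
      case 2
      then show ?thesis unfolding cycle1 cycle2 using cycle_extremal_iff by blast
    next
      case 3
      then obtain X Y where B: "bipartite_gain_graph_spectrum G \<phi> n v \<Delta> \<alpha> X Y"
        using complete_bipartite_digraph_iff by blast
      interpret B: bipartite_gain_graph_spectrum G \<phi> n v \<Delta> \<alpha> X Y by (rule B)
      from 3 have "lam = complex_of_real (\<alpha> * real n / 2)" by blast
      also note middle[OF B]
      finally have lam: "lam = of_real \<alpha> * of_nat \<Delta>" .
      have "n \<le> mult lam + 2" unfolding lam using B.switching_trivial_mult_ge 3 by blast
      moreover have "mult lam + 2 \<le> n"
      proof -
        have "(\<Delta> - 1) * (mult lam + 2) + 2 = (\<Delta> - 1) * mult lam + (2 * (\<Delta> - 1) + 2)"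
          by (simp only: distrib_left)
        also have "2 * (\<Delta> - 1) + 2 = n" using B.n_eq assms(5) by simp
        finally have "(\<Delta> - 1) * (mult lam + 2) \<le> (\<Delta> - 1) * n" using mult_bound[of lam] by linarith
        then show ?thesis by (rule mult_le_cancel1[THEN iffD1, THEN mp]) (use assms(5) in simp)
      qed
      ultimately show ?thesis using bipartite_extremal_iff[OF B] by simp
    qed
  qed
  then show ?thesis using real_bound_iff[of lam] unfolding m by simp
qed

end
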